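(* Let $p$ be a prime, let $r>1$ be an integer, let $\ell$ be a positive integer, and let $q(x)=p^{r+1}u(x)$ for some function $u\in\mathcal B$ (e.g., for a polynomial $u(x)\in\mathbb Z_p[x]$). The perturbed monomial mapping $f\colon x\mapsto x^\ell+q(x)$ is ergodic on the sphere $S_{p^{-r}}(1)$ if and only if $\ell$ is a generator of the multiplicative group $(\mathbb Z/p^2\mathbb Z)^\ast$.
   Context: $\mathbb Z_p$ is the ring of $p$-adic integers with the $p$-adic absolute value $\|\cdot\|_p$. $\mathcal B$ is the class of functions $f\colon\mathbb Z_p\to\mathbb Z_p$ of the form $f(x)=\sum_{i=0}^\infty a_i\binom{x}{i}$ with $\frac{a_i}{i!}\in\mathbb Z_p$ for all $i=0,1,2,\ldots$; equivalently $f(x)=\sum_{i\ge0}b_i\,x(x-1)\cdots(x-i+1)$ with $b_i\in\mathbb Z_p$. $S_{p^{-r}}(1)=\{z\in\mathbb Z_p:\|z-1\|_p=p^{-r}\}$. $\hat\mu_p$ is the measure induced on the sphere by the Haar measure on $\mathbb Z_p$, normalized so that the sphere has measure $1$. A function $f$ is ergodic on $S_{p^{-r}}(1)$ if $f(S_{p^{-r}}(1))\subset S_{p^{-r}}(1)$ and the restriction of $f$ to the sphere is $\hat\mu_p$-preserving and ergodic with respect to $\hat\mu_p$ (every measurable $A\subset S_{p^{-r}}(1)$ whose preimage under the restriction is $A$ has $\hat\mu_p(A)\in\{0,1\}$).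
   Formalization: The prime p is assumed odd, because the claim is false for p = 2: with r = 2, ℓ = 3, u = 0, the number 3 generates (Z/4Z)^*, but x ↦ x^3 splits the sphere modulo 32 into the cycles {5, 29} and {13, 21} and so is not ergodic. *)

theory Defs
  imports "HOL-Probability.Probability" "HOL-Algebra.Generated_Groups"
    "HOL-Number_Theory.Residues" "Berlekamp_Zassenhaus.Finite_Field"
begin

section \<open>The ring of \<open>p\<close>-adic integers\<close>

text \<open>
  The prime \<open>p\<close> is the cardinality of the index type \<open>'p\<close>.  The ring is the inverse limit of the
  rings of residues modulo \<open>p ^ n\<close>, each represented by \<open>{0..<p ^ n}\<close>.
\<close>

typedef (overloaded) ('p :: prime_card) padic_int =
  "{s :: nat \<Rightarrow> int. \<forall>n. s n \<in> {0..<int CARD('p) ^ n} \<and> s (Suc n) mod int CARD('p) ^ n = s n}"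
  morphisms residue Abs_padic_int
proof
  have "0 < CARD('p)"
    using prime_card[where 'a='p] prime_gt_0_nat by blast
  then show "(\<lambda>_. 0) \<in> {s :: nat \<Rightarrow> int. \<forall>n. s n \<in> {0..<int CARD('p) ^ n} \<and>
      s (Suc n) mod int CARD('p) ^ n = s n}"
    by simp
qed

setup_lifting type_definition_padic_int

lemma p_gt_1: "1 < int CARD('p::prime_card)"
  using prime_card[where 'a='p] prime_gt_1_nat by fastforce

lemma p_pow_pos [simp]: "0 < int CARD('p::prime_card) ^ n"
  using p_gt_1[where 'p='p] by simp

lemma residue_range: "0 \<le> residue x n" "residue (x :: 'p::prime_card padic_int) n < int CARD('p) ^ n"
  using residue[of x] by auto

lemma residue_mod [simp]: "residue (x :: 'p::prime_card padic_int) n mod int CARD('p) ^ n = residue x n"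
  using residue_range[of x n] by simp

lemma residue_mod_le:
  fixes x :: "'p::prime_card padic_int"
  assumes "n \<le> m"
  shows "residue x m mod int CARD('p) ^ n = residue x n"
  using assms
proof (induction m rule: dec_induct)
  case (step m)
  have "residue x (Suc m) mod int CARD('p) ^ n
      = residue x (Suc m) mod int CARD('p) ^ m mod int CARD('p) ^ n"
    using step.hyps by (simp add: mod_mod_cancel le_imp_power_dvd)
  also have "residue x (Suc m) mod int CARD('p) ^ m = residue x m"
    using residue[of x] by auto
  finally show ?case using step.IH by simp
qed simp

lemma residue_eqI:
  "(\<And>n. residue x n = residue y n) \<Longrightarrow> x = (y :: 'p::prime_card padic_int)"
  using residue_inject by fastforce

lemma mod_pow_Suc_mod: "(a :: int) mod q ^ Suc n mod q ^ n = a mod q ^ n"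
  by (rule mod_mod_cancel) simp

text \<open>The element given by a compatible sequence of integers.\<close>

lift_definition of_seq :: "(nat \<Rightarrow> int) \<Rightarrow> 'p::prime_card padic_int" is
  "\<lambda>s. if \<forall>n. [s (Suc n) = s n] (mod int CARD('p) ^ n)
       then (\<lambda>n. s n mod int CARD('p) ^ n) else (\<lambda>_. 0)"
  by (auto simp: cong_def mod_pow_Suc_mod simp del: power_Suc)

lemma residue_of_seq:
  assumes "\<And>n. [s (Suc n) = s n] (mod int CARD('p) ^ n)"
  shows "residue (of_seq s :: 'p::prime_card padic_int) n = s n mod int CARD('p) ^ n"
  using assms by transfer simp

instantiation padic_int :: (prime_card) comm_ring_1
begin

lift_definition zero_padic_int :: "'a padic_int" is "\<lambda>n. 0" by simp

lift_definition one_padic_int :: "'a padic_int" is "\<lambda>n. 1 mod int CARD('a) ^ n"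
  by (simp add: mod_pow_Suc_mod del: power_Suc)

lift_definition plus_padic_int :: "'a padic_int \<Rightarrow> 'a padic_int \<Rightarrow> 'a padic_int" is
  "\<lambda>s t n. (s n + t n) mod int CARD('a) ^ n"
  unfolding mod_pow_Suc_mod by (auto intro!: mod_add_cong)

lift_definition times_padic_int :: "'a padic_int \<Rightarrow> 'a padic_int \<Rightarrow> 'a padic_int" is
  "\<lambda>s t n. (s n * t n) mod int CARD('a) ^ n"
  unfolding mod_pow_Suc_mod by (auto intro!: mod_mult_cong)

lift_definition uminus_padic_int :: "'a padic_int \<Rightarrow> 'a padic_int" is
  "\<lambda>s n. (- s n) mod int CARD('a) ^ n"
  unfolding mod_pow_Suc_mod by (auto intro!: mod_minus_cong)

lift_definition minus_padic_int :: "'a padic_int \<Rightarrow> 'a padic_int \<Rightarrow> 'a padic_int" is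
  "\<lambda>s t n. (s n - t n) mod int CARD('a) ^ n"
  unfolding mod_pow_Suc_mod by (auto intro!: mod_diff_cong)

lemmas residue_simps =
  zero_padic_int.rep_eq one_padic_int.rep_eq plus_padic_int.rep_eq times_padic_int.rep_eq
  uminus_padic_int.rep_eq minus_padic_int.rep_eq

instance
proof
  fix a b c :: "'a padic_int"
  show "a * b * c = a * (b * c)"
    by (rule residue_eqI) (simp add: residue_simps mod_simps mult.assoc)
  show "a * b = b * a"
    by (rule residue_eqI) (simp add: residue_simps mult.commute)
  show "1 * a = a"
    by (rule residue_eqI) (simp add: residue_simps mod_simps)
  show "a + b + c = a + (b + c)"
    by (rule residue_eqI) (simp add: residue_simps mod_simps add.assoc)
  show "a + b = b + a"
    by (rule residue_eqI) (simp add: residue_simps add.commute)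
  show "0 + a = a"
    by (rule residue_eqI) (simp add: residue_simps)
  show "- a + a = 0"
    by (rule residue_eqI) (simp add: residue_simps mod_simps)
  show "a - b = a + - b"
    by (rule residue_eqI) (simp add: residue_simps mod_simps)
  show "(a + b) * c = a * c + b * c"
    by (rule residue_eqI) (simp add: residue_simps mod_simps distrib_right)
  show "(0 :: 'a padic_int) \<noteq> 1"
  proof
    assume "(0 :: 'a padic_int) = 1"
    then have "residue (0 :: 'a padic_int) 1 = residue (1 :: 'a padic_int) 1" by simp
    then show False using p_gt_1[where 'p='a] by (simp add: residue_simps)
  qed
qed

end

lemma residue_of_nat: "residue (of_nat k :: 'p::prime_card padic_int) n = int k mod int CARD('p) ^ n"
  by (induction k) (simp_all add: residue_simps mod_simps)

lemma residue_of_int: "residue (of_int k :: 'p::prime_card padic_int) n = k mod int CARD('p) ^ n"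
  by (cases k rule: int_cases2) (simp_all add: residue_of_nat uminus_padic_int.rep_eq mod_simps)

lemma residue_eq_0_le:
  "residue (x :: 'p::prime_card padic_int) n = 0 \<Longrightarrow> m \<le> n \<Longrightarrow> residue x m = 0"
  using residue_mod_le[of m n x] by simp

lemma residue_0_index [simp]: "residue x 0 = 0"
  using residue_range[of x 0] by simp

lemma p_pow_dvd_iff:
  "of_nat CARD('p) ^ n dvd (x :: 'p::prime_card padic_int) \<longleftrightarrow> residue x n = 0"
proof
  assume "of_nat CARD('p) ^ n dvd x"
  then obtain y where "x = of_nat (CARD('p) ^ n) * y" by auto
  then show "residue x n = 0"
    by (simp add: residue_simps residue_of_nat del: of_nat_power) simp
next
  assume 0: "residue x n = 0"
  define s where "s k = residue x (n + k) div int CARD('p) ^ n" for k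
  have s: "residue x (n + k) = int CARD('p) ^ n * s k" for k
    using residue_mod_le[of n "n + k" x] 0 by (auto simp: s_def)
  have c: "[s (Suc k) = s k] (mod int CARD('p) ^ k)" for k
  proof -
    have "[residue x (n + Suc k) = residue x (n + k)] (mod int CARD('p) ^ (n + k))"
      unfolding cong_def by (subst (1 2) residue_mod_le) auto
    then have "int CARD('p) ^ n * int CARD('p) ^ k dvd int CARD('p) ^ n * (s (Suc k) - s k)"
      unfolding s by (simp add: cong_iff_dvd_diff power_add right_diff_distrib)
    then show ?thesis
      by (simp add: cong_iff_dvd_diff)
  qed
  have "x = of_nat CARD('p) ^ n * of_seq s"
  proof (rule residue_eqI)
    fix k
    have "residue (of_nat CARD('p) ^ n * of_seq s :: 'p padic_int) k
        = (int CARD('p) ^ n * s k) mod int CARD('p) ^ k"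
      using residue_of_nat[of "CARD('p) ^ n" k, where 'p='p]
      by (simp add: residue_simps residue_of_seq[OF c] mod_simps)
    also have "\<dots> = residue x k"
      by (simp flip: s add: residue_mod_le)
    finally show "residue x k = residue (of_nat CARD('p) ^ n * of_seq s :: 'p padic_int) k" by simp
  qed
  then show "of_nat CARD('p) ^ n dvd x" by simp
qed

lemma ex_residue_neq_0: "x \<noteq> 0 \<Longrightarrow> \<exists>n. residue (x :: 'p::prime_card padic_int) n \<noteq> 0"
  by (metis residue_eqI zero_padic_int.rep_eq)

text \<open>Every nonzero element has a largest power of \<open>p\<close> dividing it.\<close>

lemma ex_padic_order:
  assumes "x \<noteq> (0 :: 'p::prime_card padic_int)"
  obtains n where "residue x n = 0" "residue x (Suc n) \<noteq> 0"
proof -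
  define m where "m = (LEAST m. residue x m \<noteq> 0)"
  have m: "residue x m \<noteq> 0"
    unfolding m_def using ex_residue_neq_0[OF assms] by (rule LeastI_ex)
  then obtain n where n: "m = Suc n" by (cases m) auto
  have "residue x n = 0"
    using not_less_Least[of n "\<lambda>m. residue x m \<noteq> 0"] n unfolding m_def by auto
  with m n that show ?thesis by blast
qed

instance padic_int :: (prime_card) idom
proof
  fix x y :: "'a padic_int"
  assume x0: "x \<noteq> 0" and y0: "y \<noteq> 0"
  obtain a where a: "residue x a = 0" "residue x (Suc a) \<noteq> 0" using ex_padic_order[OF x0] .
  obtain b where b: "residue y b = 0" "residue y (Suc b) \<noteq> 0" using ex_padic_order[OF y0] .
  define X where "X = residue x (Suc (a + b))"
  define Y where "Y = residue y (Suc (a + b))"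
  let ?p = "int CARD('a)"
  have p: "prime ?p" using prime_card[where 'a='a] by simp
  have X: "X mod ?p ^ a = 0" "X mod ?p ^ Suc a \<noteq> 0" 
    using a unfolding X_def by (simp_all add: residue_mod_le del: power_Suc)
  have Y: "Y mod ?p ^ b = 0" "Y mod ?p ^ Suc b \<noteq> 0" 
    using b unfolding Y_def by (simp_all add: residue_mod_le del: power_Suc)
  obtain X' where X': "X = ?p ^ a * X'" using X(1) by auto
  obtain Y' where Y': "Y = ?p ^ b * Y'" using Y(1) by auto
  have nX: "\<not> ?p dvd X'" using X(2) unfolding X' by auto
  have nY: "\<not> ?p dvd Y'" using Y(2) unfolding Y' by auto
  have "\<not> ?p dvd X' * Y'" using nX nY p prime_dvd_mult_iff by blast
  then have "\<not> ?p ^ (a + b) * ?p dvd ?p ^ (a + b) * (X' * Y')"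
    using p_gt_1[where 'p='a] by (subst dvd_mult_cancel_left) auto
  then have "\<not> ?p ^ Suc (a + b) dvd X * Y"
    unfolding X' Y' by (simp add: power_add mult_ac)
  then have "residue (x * y) (Suc (a + b)) \<noteq> 0"
    by (simp add: residue_simps X_def Y_def mod_eq_0_iff_dvd)
  then show "x * y \<noteq> 0" by (auto simp: zero_padic_int.rep_eq)
qed

instantiation padic_int :: (prime_card) idom_divide
begin

definition divide_padic_int :: "'a padic_int \<Rightarrow> 'a padic_int \<Rightarrow> 'a padic_int" where
  "divide_padic_int x y = (if y \<noteq> 0 \<and> y dvd x then THE z. x = z * y else 0)"

instance
  by standard (auto simp: divide_padic_int_def)

end

instance padic_int :: (prime_card) ring_char_0
proof
  show "inj (of_nat :: nat \<Rightarrow> 'a padic_int)"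
  proof (rule injI)
    fix a b
    assume ab: "(of_nat a :: 'a padic_int) = of_nat b"
    define n where "n = max a b"
    have "n < 2 ^ n" by (rule less_exp)
    also have "2 ^ n \<le> CARD('a) ^ n"
      using p_gt_1[where 'p='a] by (intro power_mono) auto
    finally have n: "int n < int CARD('a) ^ n" by (metis of_nat_less_iff of_nat_power)
    have "int a mod int CARD('a) ^ n = int b mod int CARD('a) ^ n"
      using arg_cong[OF ab, of "\<lambda>x. residue x n"] by (simp add: residue_of_nat)
    then show "a = b" using n by (simp add: n_def)
  qed
qed

section \<open>The \<open>p\<close>-adic absolute value and the topology\<close>

definition padic_norm :: "'p::prime_card padic_int \<Rightarrow> real" where
  "padic_norm x =
    (if x = 0 then 0 else 1 / real CARD('p) ^ (GREATEST n. of_nat CARD('p) ^ n dvd x))"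

lemma padic_norm_eq:
  fixes x :: "'p::prime_card padic_int"
  assumes "residue x n = 0" "residue x (Suc n) \<noteq> 0"
  shows "padic_norm x = 1 / real CARD('p) ^ n"
proof -
  have "(GREATEST n. of_nat CARD('p) ^ n dvd x) = n"
    using assms by (intro Greatest_equality) 
      (auto simp: p_pow_dvd_iff intro: ccontr residue_eq_0_le dest: residue_eq_0_le[of x _ "Suc n"])
  then show ?thesis using assms by (auto simp: padic_norm_def zero_padic_int.rep_eq)
qed

lemma padic_norm_nonneg: "0 \<le> padic_norm (x :: 'p::prime_card padic_int)"
  by (simp add: padic_norm_def)

lemma padic_norm_eq_0_iff: "padic_norm (x :: 'p::prime_card padic_int) = 0 \<longleftrightarrow> x = 0"
  using p_gt_1[where 'p='p] by (simp add: padic_norm_def)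

lemma padic_norm_le_iff:
  "padic_norm (x :: 'p::prime_card padic_int) \<le> 1 / real CARD('p) ^ n \<longleftrightarrow> residue x n = 0"
proof (cases "x = 0")
  case True
  then show ?thesis by (simp add: padic_norm_def zero_padic_int.rep_eq)
next
  case False
  obtain m where m: "residue x m = 0" "residue x (Suc m) \<noteq> 0" using ex_padic_order[OF False] .
  have p: "1 < real CARD('p)" using p_gt_1[where 'p='p] by simp
  have "padic_norm x \<le> 1 / real CARD('p) ^ n \<longleftrightarrow> n \<le> m"
    using p by (simp add: padic_norm_eq[OF m] field_simps)
  also have "\<dots> \<longleftrightarrow> residue x n = 0"
    using m residue_eq_0_le by (metis not_less_eq_eq)
  finally show ?thesis .
qed

lemma padic_norm_cases:
  fixes x :: "'p::prime_card padic_int"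
  obtains "x = 0" | n where "padic_norm x = 1 / real CARD('p) ^ n"
  by (metis ex_padic_order padic_norm_eq)

lemma padic_norm_eq_iff:
  "padic_norm (x :: 'p::prime_card padic_int) = 1 / real CARD('p) ^ n \<longleftrightarrow>
    residue x n = 0 \<and> residue x (Suc n) \<noteq> 0"
proof
  assume x: "padic_norm x = 1 / real CARD('p) ^ n"
  then have "\<not> padic_norm x \<le> 1 / real CARD('p) ^ Suc n"
    unfolding x using p_gt_1[where 'p='p] by (simp add: field_simps)
  with x show "residue x n = 0 \<and> residue x (Suc n) \<noteq> 0"
    unfolding padic_norm_le_iff[symmetric] by simp
qed (simp add: padic_norm_eq)

lemma padic_norm_minus_commute: "padic_norm (x - y) = padic_norm (y - x :: 'p::prime_card padic_int)"
proof -
  have "z dvd x - y \<longleftrightarrow> z dvd y - x" for z :: "'p padic_int"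
    by (metis dvd_minus_iff minus_diff_eq)
  then show ?thesis by (auto simp: padic_norm_def)
qed

text \<open>The strong triangle inequality.\<close>

lemma padic_norm_add: "padic_norm (x + y) \<le> max (padic_norm x) (padic_norm (y :: 'p::prime_card padic_int))"
proof (cases rule: padic_norm_cases[of x])
  case 1
  then show ?thesis by simp
next
  case x: (2 n)
  show ?thesis
  proof (cases rule: padic_norm_cases[of y])
    case 1
    then show ?thesis by simp
  next
    case y: (2 m)
    have 1: "residue x n = 0" "residue y m = 0"
      using x y padic_norm_le_iff by fastforce+
    have "residue (x + y) (min n m) = 0"
      using residue_eq_0_le[OF 1(1), of "min n m"] residue_eq_0_le[OF 1(2), of "min n m"]
      by (simp add: residue_simps)
    then have "padic_norm (x + y) \<le> 1 / real CARD('p) ^ min n m"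
      by (simp add: padic_norm_le_iff)
    then show ?thesis by (auto simp: x y min_def split: if_splits)
  qed
qed

instantiation padic_int :: (prime_card) metric_space
begin

definition dist_padic_int :: "'a padic_int \<Rightarrow> 'a padic_int \<Rightarrow> real" where
  "dist_padic_int x y = padic_norm (x - y)"

definition uniformity_padic_int :: "('a padic_int \<times> 'a padic_int) filter" where
  "uniformity_padic_int = (INF e\<in>{0 <..}. principal {(x, y). dist x y < e})"

definition open_padic_int :: "'a padic_int set \<Rightarrow> bool" where
  "open_padic_int U \<longleftrightarrow> (\<forall>x\<in>U. eventually (\<lambda>(x', y). x' = x \<longrightarrow> y \<in> U) uniformity)"

instance
proof
  fix x y z :: "'a padic_int"
  show "(dist x y = 0) = (x = y)"
    by (simp add: dist_padic_int_def padic_norm_eq_0_iff)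
  have "padic_norm (x - y) \<le> max (padic_norm (x - z)) (padic_norm (z - y))"
    using padic_norm_add[of "x - z" "z - y"] by simp
  then show "dist x y \<le> dist x z + dist y z"
    unfolding dist_padic_int_def padic_norm_minus_commute[of y z]
    using padic_norm_nonneg[of "x - z"] padic_norm_nonneg[of "z - y"] by linarith
qed (simp_all add: uniformity_padic_int_def open_padic_int_def)

end

definition padic_sphere :: "'p::prime_card padic_int \<Rightarrow> nat \<Rightarrow> 'p padic_int set" where
  "padic_sphere y r = {z. padic_norm (z - y) = 1 / real CARD('p) ^ r}"

lemma residue_diff_eq_0_iff:
  "residue (x - y) n = 0 \<longleftrightarrow> residue x n = residue (y :: 'p::prime_card padic_int) n"
proof -
  have "residue (x - y) n = 0 \<longleftrightarrow> [residue x n = residue y n] (mod int CARD('p) ^ n)"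
    by (simp add: residue_simps cong_iff_dvd_diff mod_eq_0_iff_dvd)
  then show ?thesis by (simp add: cong_def)
qed

section \<open>The ball basis and the Borel sets\<close>

text \<open>Closed balls, plus the empty set for an out-of-range residue \<open>k\<close>.\<close>

definition residue_ball :: "nat \<Rightarrow> int \<Rightarrow> 'p::prime_card padic_int set" where
  "residue_ball n k = {x. residue x n = k}"

definition residue_balls :: "'p::prime_card padic_int set set" where
  "residue_balls = range (\<lambda>(n, k). residue_ball n k)"

lemma residue_ball_in_balls [simp, intro]: "residue_ball n k \<in> residue_balls"
  by (auto simp: residue_balls_def)

lemma open_residue_ball: "open (residue_ball n k :: 'p::prime_card padic_int set)"
  unfolding open_dist
proof
  fix x :: "'p padic_int"
  assume x: "x \<in> residue_ball n k"
  have "y \<in> residue_ball n k" if "dist y x < 1 / real CARD('p) ^ n" for y :: "'p padic_int"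
    using that x padic_norm_le_iff[of "y - x" n]
    by (auto simp: dist_padic_int_def residue_ball_def residue_diff_eq_0_iff)
  moreover have "0 < 1 / real CARD('p) ^ n" using p_gt_1[where 'p='p] by simp
  ultimately show "\<exists>e>0. \<forall>y. dist y x < e \<longrightarrow> y \<in> residue_ball n k" by blast
qed

lemma residue_ball_within:
  assumes "open U" "(x :: 'p::prime_card padic_int) \<in> U"
  obtains n where "residue_ball n (residue x n) \<subseteq> U"
proof -
  obtain e where e: "e > 0" "\<And>y. dist y x < e \<Longrightarrow> y \<in> U"
    using assms unfolding open_dist by blast
  have "1 / real CARD('p) < 1" using p_gt_1[where 'p='p] by simp
  then obtain n where n: "(1 / real CARD('p)) ^ n < e" using e real_arch_pow_inv by blast
  have "residue_ball n (residue x n) \<subseteq> U"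
  proof
    fix y :: "'p padic_int"
    assume "y \<in> residue_ball n (residue x n)"
    then have "padic_norm (y - x) \<le> 1 / real CARD('p) ^ n"
      by (simp add: residue_ball_def padic_norm_le_iff residue_diff_eq_0_iff)
    then show "y \<in> U" using n by (intro e) (simp add: dist_padic_int_def power_one_over)
  qed
  then show ?thesis by (rule that)
qed

lemma topological_basis_residue_balls: "topological_basis (residue_balls :: 'p::prime_card padic_int set set)"
proof (rule topological_basisI)
  show "open B" if "B \<in> residue_balls" for B :: "'p padic_int set"
    using that by (auto simp: residue_balls_def open_residue_ball)
  fix U and x :: "'p padic_int"
  assume "open U" "x \<in> U"
  then obtain n where "residue_ball n (residue x n) \<subseteq> U" by (rule residue_ball_within)
  then show "\<exists>B\<in>residue_balls. x \<in> B \<and> B \<subseteq> U"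
    by (intro bexI[of _ "residue_ball n (residue x n)"] conjI residue_ball_in_balls)
      (simp_all add: residue_ball_def)
qed

lemma sets_borel_padic:
  "sets borel = sigma_sets UNIV (residue_balls :: 'p::prime_card padic_int set set)"
proof -
  have "countable (residue_balls :: 'p padic_int set set)"
    unfolding residue_balls_def by simp
  then have "borel = sigma UNIV (residue_balls :: 'p padic_int set set)"
    using topological_basis_residue_balls by (rule borel_eq_countable_basis)
  then show ?thesis by (metis Pow_UNIV sets_measure_of subset_UNIV)
qed

lemma residue_ball_neg: "residue_ball n (- 1) = ({} :: 'p::prime_card padic_int set)"
proof -
  have "residue x n \<noteq> - 1" for x :: "'p padic_int"
    using residue_range(1)[of x n] by linarith
  then show ?thesis by (simp add: residue_ball_def)
qed

lemma Int_stable_residue_balls: "Int_stable (residue_balls :: 'p::prime_card padic_int set set)"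
proof (rule Int_stableI)
  have *: "residue_ball n k \<inter> residue_ball m l \<in> (residue_balls :: 'p padic_int set set)"
    if "n \<le> m" for n m k l
  proof (cases "l mod int CARD('p) ^ n = k")
    case True
    then have "residue_ball n k \<inter> residue_ball m l = (residue_ball m l :: 'p padic_int set)"
      using residue_mod_le[OF that, where 'p='p] by (auto simp: residue_ball_def)
    then show ?thesis by simp
  next
    case False
    then have "residue_ball n k \<inter> residue_ball m l = ({} :: 'p padic_int set)"
      using residue_mod_le[OF that, where 'p='p] by (auto simp: residue_ball_def)
    then show ?thesis using residue_ball_in_balls[of 0 "- 1"] by (simp add: residue_ball_neg)
  qed
  fix A B :: "'p padic_int set"
  assume "A \<in> residue_balls" "B \<in> residue_balls"
  then obtain n k m l where "A = residue_ball n k" "B = residue_ball m l"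
    by (auto simp: residue_balls_def)
  then show "A \<inter> B \<in> residue_balls"
    using *[of n m k l] *[of m n l k] by (cases n m rule: le_cases) (auto simp: Int_commute)
qed

lemma measure_eqI_residue_balls:
  fixes M N :: "'p::prime_card padic_int measure"
  assumes "sets M = sets borel" "sets N = sets borel" "emeasure M UNIV \<noteq> \<infinity>"
    and eq: "\<And>n k. emeasure M (residue_ball n k) = emeasure N (residue_ball n k)"
  shows "M = N"
proof (rule measure_eqI_generator_eq[where E = residue_balls and \<Omega> = UNIV and A = "\<lambda>_. UNIV"])
  show "range (\<lambda>_. UNIV) \<subseteq> (residue_balls :: 'p padic_int set set)"
    using residue_ball_in_balls[of 0 0] by (auto simp: residue_ball_def)
  show "emeasure M X = emeasure N X" if "X \<in> residue_balls" for X
    using that eq by (auto simp: residue_balls_def)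
qed (use assms in \<open>auto simp: Int_stable_residue_balls sets_borel_padic\<close>)

section \<open>Haar measure\<close>

definition is_haar_measure :: "'p::prime_card padic_int measure \<Rightarrow> bool" where
  "is_haar_measure M \<longleftrightarrow> sets M = sets borel \<and> emeasure M UNIV = 1 \<and>
     (\<forall>a. \<forall>A \<in> sets borel. emeasure M ((+) a ` A) = emeasure M A)"

definition haar_measure :: "'p::prime_card padic_int measure" where
  "haar_measure = (THE M. is_haar_measure M)"

lemma haar_residue_ball:
  fixes M :: "'p::prime_card padic_int measure"
  assumes M: "is_haar_measure M" and k: "k \<in> {0..<int CARD('p) ^ n}"
  shows "emeasure M (residue_ball n k) = 1 / of_nat (CARD('p) ^ n)"
proof -
  let ?B = "residue_ball n :: int \<Rightarrow> 'p padic_int set"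
  have [measurable]: "?B j \<in> sets borel" for j
    by (intro borel_open open_residue_ball)
  have sets: "sets M = sets borel" using M by (simp add: is_haar_measure_def)
  have translate: "emeasure M (?B j) = emeasure M (?B 0)" if j: "j \<in> {0..<int CARD('p) ^ n}" for j
  proof -
    have rj: "residue (of_nat (nat j) :: 'p padic_int) n = j"
      using j by (simp add: residue_of_int)
    have "(+) (of_nat (nat j)) ` ?B 0 = ?B j"
    proof (intro equalityI subsetI)
      fix x assume "x \<in> (+) (of_nat (nat j)) ` ?B 0"
      then show "x \<in> ?B j" using rj j by (auto simp: residue_ball_def residue_simps)
    next
      fix x :: "'p padic_int"
      assume "x \<in> ?B j"
      then have "x - of_nat (nat j) \<in> ?B 0" 
        using rj by (simp add: residue_ball_def residue_diff_eq_0_iff)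
      then show "x \<in> (+) (of_nat (nat j)) ` ?B 0"
        by (intro image_eqI[of _ _ "x - of_nat (nat j)"]) auto
    qed
    then show ?thesis using M by (metis is_haar_measure_def \<open>?B 0 \<in> sets borel\<close>)
  qed
  have "1 = emeasure M (\<Union>j\<in>{0..<int CARD('p) ^ n}. ?B j)"
  proof -
    have "(\<Union>j\<in>{0..<int CARD('p) ^ n}. ?B j) = UNIV"
      using residue_range by (fastforce simp: residue_ball_def)
    then show ?thesis using M by (simp add: is_haar_measure_def)
  qed
  also have "\<dots> = (\<Sum>j\<in>{0..<int CARD('p) ^ n}. emeasure M (?B j))"
    by (intro sum_emeasure[symmetric]) (auto simp: sets disjoint_family_on_def borel_open open_residue_ball, simp add: residue_ball_def)
  also have "\<dots> = (\<Sum>j\<in>{0..<int CARD('p) ^ n}. emeasure M (?B 0))"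
    by (intro sum.cong translate) auto
  also have "\<dots> = of_nat (CARD('p) ^ n) * emeasure M (?B 0)"
    by (simp add: nat_power_eq)
  finally have 1: "of_nat (CARD('p) ^ n) * emeasure M (?B 0) = 1" by simp
  have "of_nat (CARD('p) ^ n) \<noteq> (0 :: ennreal)" "of_nat (CARD('p) ^ n) \<noteq> (\<top> :: ennreal)"
    using p_gt_1[where 'p='p] by (auto simp del: of_nat_power)
  then have "emeasure M (?B 0) = 1 / of_nat (CARD('p) ^ n)"
    using 1 by (metis ennreal_mult_divide_eq mult.commute)
  then show ?thesis using translate[OF k] by simp
qed

lemma haar_measure_unique:
  assumes M: "is_haar_measure M" and N: "is_haar_measure (N :: 'p::prime_card padic_int measure)"
  shows "M = N"
proof (rule measure_eqI_residue_balls)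
  fix n k
  show "emeasure M (residue_ball n k) = emeasure N (residue_ball n k)"
  proof (cases "k \<in> {0..<int CARD('p) ^ n}")
    case False
    then have "residue_ball n k = ({} :: 'p padic_int set)"
      using residue_range by (fastforce simp: residue_ball_def)
    then show ?thesis by simp
  qed (simp only: haar_residue_ball[OF M] haar_residue_ball[OF N])
qed (use M N in \<open>auto simp: is_haar_measure_def\<close>)


text \<open>Existence: the image of the uniform product measure on digit sequences.\<close>

definition digit_sum :: "int \<Rightarrow> (nat \<Rightarrow> int) \<Rightarrow> nat \<Rightarrow> int" where
  "digit_sum q d n = (\<Sum>i<n. (d i mod q) * q ^ i)"

lemma digit_sum_range:
  assumes "q > 0"
  shows "0 \<le> digit_sum q d n" "digit_sum q d n < q ^ n"
proof -
  have "0 \<le> digit_sum q d n \<and> digit_sum q d n < q ^ n"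
  proof (induction n)
    case (Suc n)
    have "(d n mod q) * q ^ n \<le> (q - 1) * q ^ n"
      using assms by (intro mult_right_mono) auto
    moreover have "0 \<le> (d n mod q) * q ^ n" using assms by simp
    ultimately show ?case using Suc by (auto simp: digit_sum_def algebra_simps)
  qed (simp add: digit_sum_def)
  then show "0 \<le> digit_sum q d n" "digit_sum q d n < q ^ n" by auto
qed

lemma digit_sum_eq_iff:
  assumes "q > 0" "k \<in> {0..<q ^ n}"
  shows "digit_sum q d n = k \<longleftrightarrow> (\<forall>i<n. d i mod q = k mod q ^ Suc i div q ^ i)"
  using assms(2)
proof (induction n arbitrary: k)
  case (Suc n)
  have *: "k mod q ^ n mod q ^ Suc i = k mod q ^ Suc i" if "i < n" for i
    using that by (intro mod_mod_cancel le_imp_power_dvd) simp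
  have IH: "digit_sum q d n = k mod q ^ n \<longleftrightarrow> (\<forall>i<n. d i mod q = k mod q ^ Suc i div q ^ i)"
    using Suc.IH[of "k mod q ^ n"] assms(1) * by (simp del: power_Suc)
  have k: "k mod q ^ Suc n = k" using Suc.prems by (simp del: power_Suc)
  have S: "digit_sum q d (Suc n) = digit_sum q d n + (d n mod q) * q ^ n"
    by (simp add: digit_sum_def)
  have r: "0 \<le> digit_sum q d n" "digit_sum q d n < q ^ n"
    using digit_sum_range[OF assms(1)] by auto
  have "digit_sum q d (Suc n) = k \<longleftrightarrow> digit_sum q d n = k mod q ^ n \<and> d n mod q = k div q ^ n"
  proof
    assume "digit_sum q d (Suc n) = k"
    then show "digit_sum q d n = k mod q ^ n \<and> d n mod q = k div q ^ n"
      using r assms(1) unfolding S by auto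
  next
    assume "digit_sum q d n = k mod q ^ n \<and> d n mod q = k div q ^ n"
    then show "digit_sum q d (Suc n) = k" unfolding S by (simp add: mod_div_mult_eq)
  qed
  also have "\<dots> \<longleftrightarrow> (\<forall>i<Suc n. d i mod q = k mod q ^ Suc i div q ^ i)"
    unfolding IH using k by (auto simp: less_Suc_eq simp del: power_Suc)
  finally show ?case .
qed (simp add: digit_sum_def)

lemma residue_of_seq_digit_sum:
  "residue (of_seq (digit_sum (int CARD('p)) d) :: 'p::prime_card padic_int) n
    = digit_sum (int CARD('p)) d n"
proof -
  have "0 < int CARD('p)" using p_gt_1[where 'p='p] by simp
  from digit_sum_range[OF this] show ?thesis
    by (subst residue_of_seq) (auto simp: digit_sum_def cong_def)
qed

lemma ex_haar_measure: "\<exists>M :: 'p::prime_card padic_int measure. is_haar_measure M"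
proof -
  let ?p = "int CARD('p)"
  have p: "0 < ?p" "1 < ?p" using p_gt_1[where 'p='p] by auto
  define U where "U = measure_pmf (pmf_of_set {0..<?p})"
  define D where "D = Pi\<^sub>M (UNIV :: nat set) (\<lambda>_. U)"
  define F :: "(nat \<Rightarrow> int) \<Rightarrow> 'p padic_int" where "F d = of_seq (digit_sum ?p d)" for d
  define X where "X k i = {a. a mod ?p = k mod ?p ^ Suc i div ?p ^ i}" for k i
  interpret U: prob_space U unfolding U_def by (rule prob_space_measure_pmf)
  interpret D: product_prob_space "\<lambda>_. U" "UNIV :: nat set" ..
  have spD: "space D = UNIV" by (simp add: D_def U_def space_PiM)
  have F_ball: "F -` residue_ball n k = prod_emb UNIV (\<lambda>_. U) {..<n} (Pi\<^sub>E {..<n} (X k))"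
    if "k \<in> {0..<?p ^ n}" for n k
    using digit_sum_eq_iff[OF p(1) that]
    by (auto simp: F_def residue_ball_def residue_of_seq_digit_sum X_def prod_emb_def U_def PiE_def Pi_iff
        simp del: power_Suc)
  have ball_empty: "residue_ball n k = ({} :: 'p padic_int set)" if "k \<notin> {0..<?p ^ n}" for n k
    using that residue_range by (fastforce simp: residue_ball_def)
  have F [measurable]: "F \<in> measurable D borel"
  proof (rule measurable_sigma_sets[OF sets_borel_padic])
    fix B :: "'p padic_int set"
    assume "B \<in> residue_balls"
    then obtain n k where B: "B = residue_ball n k" by (auto simp: residue_balls_def)
    show "F -` B \<inter> space D \<in> sets D"
    proof (cases "k \<in> {0..<?p ^ n}")
      case True
      show ?thesis
        unfolding B spD Int_UNIV_right F_ball[OF True] unfolding D_def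
        by (intro sets_PiM_I) (auto simp: U_def)
    qed (simp add: B ball_empty)
  qed auto
  define M where "M = distr D borel F"
  have setsM [measurable_cong]: "sets M = sets borel" by (simp add: M_def)
  have U_X: "emeasure U (X k i) = 1 / of_nat CARD('p)" if "0 \<le> k" for k i
  proof -
    define c where "c = k mod ?p ^ Suc i div ?p ^ i"
    define b where "b = ?p ^ i"
    define a where "a = k mod ?p ^ Suc i"
    have b: "0 < b" using p by (simp add: b_def)
    have a: "0 \<le> a" "a < ?p * b" using p by (simp_all add: a_def b_def)
    have "a div b * b \<le> a" using b by (simp flip: minus_mod_eq_div_mult)
    then have "a div b * b < ?p * b" using a by linarith
    then have c: "0 \<le> c" "c < ?p"
      using a b unfolding c_def a_def[symmetric] b_def[symmetric]
      by (simp_all add: pos_imp_zdiv_nonneg_iff)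
    have "{0..<?p} \<inter> X k i = {c}"
      using c by (auto simp: X_def c_def[symmetric] simp del: power_Suc)
    then show ?thesis
      using p divide_ennreal[of 1 "real CARD('p)"] unfolding U_def
      by (simp add: emeasure_pmf_of_set ennreal_of_nat_eq_real_of_nat)
  qed
  have M_ball: "emeasure M (residue_ball n k) = (1 / of_nat CARD('p)) ^ n"
    if k: "k \<in> {0..<?p ^ n}" for n k
  proof -
    have "emeasure M (residue_ball n k) = emeasure D (F -` residue_ball n k)"
      unfolding M_def by (subst emeasure_distr) (auto simp: spD intro!: borel_open open_residue_ball)
    also have "\<dots> = (\<Prod>i<n. emeasure U (X k i))"
      unfolding F_ball[OF k] D_def by (rule D.emeasure_PiM_emb) (auto simp: U_def)
    also have "\<dots> = (1 / of_nat CARD('p)) ^ n"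
      using k U_X by simp
    finally show ?thesis .
  qed
  have M_UNIV: "emeasure M UNIV = 1"
    using M_ball[of 0 0] by (simp add: residue_ball_def)
  have "is_haar_measure M"
    unfolding is_haar_measure_def
  proof (intro conjI allI ballI setsM M_UNIV)
    fix a :: "'p padic_int" and A :: "'p padic_int set"
    assume A [measurable]: "A \<in> sets borel"
    define T where "T x = x - a" for x
    define sh where "sh n k = (k + residue a n) mod ?p ^ n" for n k
    have T_ball: "T -` residue_ball n k = residue_ball n (sh n k)" 
      and sh: "sh n k \<in> {0..<?p ^ n}" if k: "k \<in> {0..<?p ^ n}" for n k
    proof -
      show "sh n k \<in> {0..<?p ^ n}" by (simp add: sh_def)
      have "residue (x - a) n = k \<longleftrightarrow> residue x n = sh n k" for x
      proof -
        have "residue (x - a) n = k \<longleftrightarrow> [residue x n - residue a n = k] (mod ?p ^ n)"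
          using k by (simp add: residue_simps cong_def)
        also have "\<dots> \<longleftrightarrow> [residue x n = k + residue a n] (mod ?p ^ n)"
          by (simp add: cong_iff_dvd_diff algebra_simps)
        finally show ?thesis by (simp add: cong_def sh_def)
      qed
      then show "T -` residue_ball n k = residue_ball n (sh n k)"
        by (auto simp: T_def residue_ball_def)
    qed
    have T [measurable]: "T \<in> measurable borel borel"
    proof (rule measurable_sigma_sets[OF sets_borel_padic])
      fix B :: "'p padic_int set"
      assume "B \<in> residue_balls"
      then obtain n k where B: "B = residue_ball n k" by (auto simp: residue_balls_def)
      show "T -` B \<inter> space borel \<in> sets borel"
      proof (cases "k \<in> {0..<?p ^ n}")
        case True
        then show ?thesis
          by (simp add: B T_ball borel_open open_residue_ball)
      qed (simp add: B ball_empty)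
    qed auto
    have "M = distr M borel T"
    proof (rule measure_eqI_residue_balls)
      fix n k
      have "emeasure (distr M borel T) (residue_ball n k) = emeasure M (T -` residue_ball n k)"
        by (subst emeasure_distr)
          (auto intro!: borel_open open_residue_ball simp: sets_eq_imp_space_eq[OF setsM])
      also have "\<dots> = emeasure M (residue_ball n k)"
        using M_ball T_ball sh ball_empty by (cases "k \<in> {0..<?p ^ n}") auto
      finally show "emeasure M (residue_ball n k) = emeasure (distr M borel T) (residue_ball n k)"
        by simp
    qed (simp_all add: setsM M_UNIV)
    then have "emeasure M A = emeasure (distr M borel T) A" by simp
    also have "\<dots> = emeasure M (T -` A)"
      by (subst emeasure_distr) (auto simp: sets_eq_imp_space_eq[OF setsM])
    also have "T -` A = (+) a ` A"
      by (force simp: T_def image_iff)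
    finally show "emeasure M ((+) a ` A) = emeasure M A" by simp
  qed
  then show ?thesis by blast
qed

lemma is_haar_measure_haar_measure: "is_haar_measure (haar_measure :: 'p::prime_card padic_int measure)"
  unfolding haar_measure_def
  using ex_haar_measure[where 'p='p] haar_measure_unique by (metis theI)

section \<open>Binomial coefficients and the class \<open>\<B>\<close>\<close>

lemma padic_unit:
  fixes x :: "'p::prime_card padic_int"
  assumes "residue x 1 \<noteq> 0"
  shows "x dvd 1"
proof -
  let ?p = "int CARD('p)"
  have p: "prime ?p" using prime_card[where 'a='p] by simp
  have cop: "coprime (residue x n) (?p ^ n)" for n
  proof (cases n)
    case (Suc m)
    have "residue x n mod ?p = residue x 1" using residue_mod_le[of 1 n x] Suc by simp
    then have "\<not> ?p dvd residue x n" using assms by auto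
    then show ?thesis
      using p by (meson coprime_commute coprime_power_left_iff prime_imp_coprime)
  qed simp
  then have "\<forall>n. \<exists>y. [residue x n * y = 1] (mod ?p ^ n)"
    by (simp add: cong_solve_coprime_int)
  then obtain s where s: "\<And>n. [residue x n * s n = 1] (mod ?p ^ n)" by metis
  have c: "[s (Suc n) = s n] (mod ?p ^ n)" for n
  proof -
    have "[residue x (Suc n) * s (Suc n) = 1] (mod ?p ^ n)"
      by (rule cong_dvd_modulus[OF s]) simp
    moreover have "[residue x (Suc n) = residue x n] (mod ?p ^ n)"
      by (simp add: cong_def residue_mod_le)
    ultimately have "[residue x n * s (Suc n) = 1] (mod ?p ^ n)"
      by (metis cong_scalar_right cong_sym cong_trans)
    then have "[residue x n * s (Suc n) = residue x n * s n] (mod ?p ^ n)"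
      using s cong_sym cong_trans by blast
    then show ?thesis using cong_mult_lcancel[OF cop] by blast
  qed
  have "1 = x * of_seq s"
    by (rule residue_eqI) (use s in \<open>simp add: residue_simps residue_of_seq[OF c] mod_simps cong_def\<close>)
  then show ?thesis by (rule dvdI)
qed

lemma of_nat_dvd_padic:
  assumes "k \<noteq> 0"
  obtains v where "\<And>x :: 'p::prime_card padic_int. of_nat k dvd x \<longleftrightarrow> residue x v = 0"
proof -
  have p: "prime CARD('p)" using prime_card[where 'a='p] .
  then have "\<not> is_unit CARD('p)" using not_prime_unit by blast
  then obtain m where m: "k = CARD('p) ^ multiplicity CARD('p) k * m" "\<not> CARD('p) dvd m"
    using multiplicity_decompose'[of k "CARD('p)"] assms by metis
  have "residue (of_nat m :: 'p padic_int) 1 \<noteq> 0"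
    using m(2) by (simp add: residue_of_nat dvd_eq_mod_eq_0 flip: of_nat_mod)
  then have "(of_nat m :: 'p padic_int) dvd 1" by (rule padic_unit)
  then have "of_nat k dvd x \<longleftrightarrow> residue x (multiplicity CARD('p) k) = 0" for x :: "'p padic_int"
    by (subst m(1)) (simp add: p_pow_dvd_iff mult_unit_dvd_iff)
  then show ?thesis by (rule that)
qed

text \<open>
  This is the formula defining \<open>x gchoose i\<close>, whose syntax is restricted to fields.  The division
  is exact, by the lemma below.
\<close>

definition padic_binomial :: "'p::prime_card padic_int \<Rightarrow> nat \<Rightarrow> 'p padic_int" where
  "padic_binomial x i = (\<Prod>j=0..<i. x - of_nat j) div fact i"

lemma fact_mult_padic_binomial:
  "fact i * padic_binomial x i = (\<Prod>j=0..<i. x - of_nat j :: 'p::prime_card padic_int)"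
proof -
  have "(fact i :: nat) \<noteq> 0" by simp
  then obtain v where v: "\<And>x :: 'p padic_int. of_nat (fact i) dvd x \<longleftrightarrow> residue x v = 0"
    by (rule of_nat_dvd_padic) blast
  define t where "t = nat (residue x v)"
  have t: "residue x v = residue (of_nat t :: 'p padic_int) v"
    using residue_range[of x v] by (simp add: residue_of_int t_def)
  have "residue (\<Prod>j\<in>A. x - of_nat j) v = residue (\<Prod>j\<in>A. of_nat t - of_nat j :: 'p padic_int) v"
    if "finite A" for A
    using that
  proof induction
    case (insert j A)
    have "residue (x - of_nat j) v = residue (of_nat t - of_nat j :: 'p padic_int) v"
      using t by (simp add: minus_padic_int.rep_eq)
    with insert show ?case by (simp add: times_padic_int.rep_eq)
  qed simp
  moreover have "(\<Prod>j=0..<i. of_nat t - of_nat j :: 'p padic_int) = of_nat (fact i) * of_nat (t choose i)"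
  proof -
    have "(fact i :: rat) * (of_nat t gchoose i) = (\<Prod>j=0..<i. of_nat t - of_nat j)"
      by (rule gbinomial_mult_fact)
    then have "(of_int (int (fact i * (t choose i))) :: rat) = of_int (\<Prod>j=0..<i. int t - int j)"
      by (simp add: binomial_gbinomial)
    then have "int (fact i * (t choose i)) = (\<Prod>j=0..<i. int t - int j)"
      by (simp only: of_int_eq_iff)
    then have "(of_int (int (fact i * (t choose i))) :: 'p padic_int) = of_int (\<Prod>j=0..<i. int t - int j)"
      by (rule arg_cong)
    then show ?thesis by simp
  qed
  ultimately have "residue (\<Prod>j=0..<i. x - of_nat j) v = 0"
    using v by (metis dvd_triv_left finite_atLeastLessThan)
  then have "fact i dvd (\<Prod>j=0..<i. x - of_nat j)"
    using v by (simp add: of_nat_fact)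
  then show ?thesis
    unfolding padic_binomial_def by simp
qed

text \<open>The condition \<open>a i / fact i \<in> \<int>\<^sub>p\<close> is divisibility of \<open>a i\<close> by \<open>fact i\<close>.\<close>

definition class_B :: "('p::prime_card padic_int \<Rightarrow> 'p padic_int) set" where
  "class_B = {f. \<exists>a. (\<forall>i. fact i dvd a i) \<and> (\<forall>x. (\<lambda>i. a i * padic_binomial x i) sums f x)}"

section \<open>Ergodicity on spheres\<close>

definition measure_preserving :: "'a measure \<Rightarrow> ('a \<Rightarrow> 'a) \<Rightarrow> bool" where
  "measure_preserving M T \<longleftrightarrow>
    T \<in> measurable M M \<and> (\<forall>A\<in>sets M. emeasure M (T -` A \<inter> space M) = emeasure M A)"

definition ergodic :: "'a measure \<Rightarrow> ('a \<Rightarrow> 'a) \<Rightarrow> bool" where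
  "ergodic M T \<longleftrightarrow>
    (\<forall>A\<in>sets M. T -` A \<inter> space M = A \<longrightarrow> emeasure M A = 0 \<or> emeasure M A = 1)"

definition sphere_measure :: "'p::prime_card padic_int \<Rightarrow> nat \<Rightarrow> 'p padic_int measure" where
  "sphere_measure y r = scale_measure (1 / emeasure haar_measure (padic_sphere y r))
    (restrict_space haar_measure (padic_sphere y r))"

definition ergodic_on_sphere ::
    "('p::prime_card padic_int \<Rightarrow> 'p padic_int) \<Rightarrow> 'p padic_int \<Rightarrow> nat \<Rightarrow> bool" where
  "ergodic_on_sphere f y r \<longleftrightarrow> f ` padic_sphere y r \<subseteq> padic_sphere y r \<and>
    measure_preserving (sphere_measure y r) f \<and> ergodic (sphere_measure y r) f"

section \<open>Generators of unit groups of residue rings\<close>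

definition generates_residue_units :: "nat \<Rightarrow> nat \<Rightarrow> bool" where
  "generates_residue_units n g \<longleftrightarrow>
    (let G = units_of (residue_ring (int n)); h = int g mod int n
     in h \<in> carrier G \<and> generate G {h} = carrier G)"

section \<open>The prime 2\<close>

text \<open>
  Cubing is not ergodic on the sphere of radius \<open>1/4\<close> about 1 in the 2-adic integers, although 3
  generates the units modulo 4: modulo 32 it splits the sphere into the cycles \<open>{5, 29}\<close> and
  \<open>{13, 21}\<close>.  Hence the ergodicity criterion for perturbed monomials needs \<open>p\<close> to be odd.
\<close>

lemma mod_8_eq_5: "0 \<le> k \<Longrightarrow> k < 8 \<Longrightarrow> (k mod 4 = 1 \<and> k \<noteq> 1) = (k = (5 :: int))"
  by presburger

lemma mod_32_sphere: "0 \<le> k \<Longrightarrow> k < 32 \<Longrightarrow>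
    (k mod 8 = 5) = (k = (5 :: int) \<or> k = 13 \<or> k = 21 \<or> k = 29)"
  by presburger

lemma cube_not_ergodic_2: "\<not> ergodic_on_sphere (\<lambda>x :: bool padic_int. x ^ 3) 1 2"
proof
  let ?S = "padic_sphere (1 :: bool padic_int) 2"
  let ?\<mu> = "haar_measure :: bool padic_int measure"
  let ?B = "residue_ball 5 :: int \<Rightarrow> bool padic_int set"
  let ?A = "?B 5 \<union> ?B 29"
  assume "ergodic_on_sphere (\<lambda>x :: bool padic_int. x ^ 3) 1 2"
  then have erg: "ergodic (sphere_measure 1 2) (\<lambda>x :: bool padic_int. x ^ 3)"
    by (simp add: ergodic_on_sphere_def)
  have haar: "is_haar_measure ?\<mu>" by (rule is_haar_measure_haar_measure)
  have sets [simp]: "sets ?\<mu> = sets borel" 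
    using haar by (simp add: is_haar_measure_def)
  have space [simp]: "space ?\<mu> = UNIV" using sets_eq_imp_space_eq[OF sets] by simp
  have r2: "residue z 2 = residue z 3 mod 4" and r3: "residue z 3 = residue z 5 mod 8"
    and rng: "residue z 3 \<in> {0..<8}" "residue z 5 \<in> {0..<32}" for z :: "bool padic_int"
    using residue_mod_le[of 2 3 z] residue_mod_le[of 3 5 z] residue_range[of z 3]
      residue_range[of z 5] by simp_all
  have S: "?S = residue_ball 3 5"
  proof -
    have "z \<in> ?S \<longleftrightarrow> residue z 2 = 1 \<and> residue z 3 \<noteq> 1" for z
      using padic_norm_eq_iff[of "z - 1" 2]
      unfolding padic_sphere_def residue_diff_eq_0_iff one_padic_int.rep_eq
      by (simp add: numeral_3_eq_3 numeral_2_eq_2)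
    then have "z \<in> ?S \<longleftrightarrow> residue z 3 = 5" for z
      using mod_8_eq_5[of "residue z 3"] rng(1)[of z] unfolding r2 by simp
    then show ?thesis by (auto simp: residue_ball_def)
  qed
  have AS: "?A \<subseteq> ?S"
    unfolding S using r3 by (auto simp: residue_ball_def)
  have Smeas: "?S \<in> sets borel" unfolding S by (intro borel_open open_residue_ball)
  have Ameas: "?A \<in> sets (sphere_measure 1 2)"
    using AS Smeas by (simp add: sphere_measure_def sets_restrict_space_iff borel_open open_residue_ball)
  have "(\<lambda>x. x ^ 3) -` ?A \<inter> ?S = ?A"
  proof -
    have "residue (z ^ 3) 5 \<in> {5, 29} \<and> z \<in> ?S \<longleftrightarrow> residue z 5 \<in> {5, 29}" for z
    proof -
      have "residue (z ^ 3) 5 = residue z 5 * (residue z 5 * residue z 5 mod 32) mod 32"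
        by (simp add: power3_eq_cube times_padic_int.rep_eq mult.assoc mult.commute)
      moreover have "z \<in> ?S \<longleftrightarrow> residue z 5 \<in> {5, 13, 21, 29}"
        using rng(2)[of z] mod_32_sphere[of "residue z 5"] unfolding S residue_ball_def by (simp add: r3)
      ultimately show ?thesis by auto
    qed
    then show ?thesis by (auto simp: residue_ball_def)
  qed
  then have "emeasure (sphere_measure 1 2) ?A = 0 \<or> emeasure (sphere_measure 1 2) ?A = 1"
    using erg Ameas unfolding ergodic_def
    by (metis (no_types, lifting) UNIV_I \<open>space ?\<mu> = UNIV\<close> inf_top_right space_restrict_space space_scale_measure sphere_measure_def)
  moreover have "emeasure (sphere_measure 1 2) ?A = ennreal (1 / 2)"
  proof -
    have "emeasure ?\<mu> ?A = emeasure ?\<mu> (?B 5) + emeasure ?\<mu> (?B 29)"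
      by (intro plus_emeasure[symmetric]) (auto simp: residue_ball_def borel_open open_residue_ball[unfolded residue_ball_def])
    also have "\<dots> = ennreal (1 / 16)"
      using haar_residue_ball[OF haar, of 5 5] haar_residue_ball[OF haar, of 29 5]
      by (simp add: divide_ennreal flip: ennreal_numeral ennreal_1 ennreal_plus)
    finally have A: "emeasure ?\<mu> ?A = ennreal (1 / 16)" .
    have "emeasure ?\<mu> ?S = ennreal (1 / 8)"
      unfolding S using haar_residue_ball[OF haar, of 5 3]
      by (simp add: divide_ennreal flip: ennreal_numeral ennreal_1)
    then have "emeasure (sphere_measure 1 2) ?A = 1 / ennreal (1 / 8) * ennreal (1 / 16)"
      using A AS Smeas by (simp add: sphere_measure_def emeasure_restrict_space)
    also have "\<dots> = ennreal (1 / 2)"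
      using divide_ennreal[of 1 "1 / 8"] ennreal_mult[of 8 "1 / 16"]
      by (simp del: ennreal_numeral)
    finally show ?thesis .
  qed
  moreover have "ennreal (1 / 2) \<noteq> 0" "ennreal (1 / 2) \<noteq> 1"
    by (simp_all only: ennreal_eq_0_iff ennreal_eq_1)
  ultimately show False by metis
qed

lemma three_generates_units_4: "generates_residue_units (CARD(bool) ^ 2) 3"
proof -
  define R where "R = residue_ring 4"
  interpret residues 4 R by unfold_locales (simp_all add: R_def)
  have "coprime x 4 \<longleftrightarrow> odd x" for x :: int
    using coprime_power_right_iff[of x 2 2] by simp
  moreover have "0 < x \<and> x < 4 \<and> odd x \<longleftrightarrow> x = 1 \<or> x = 3" for x :: int
    by presburger
  ultimately have u: "Units R = {1, 3}"
    unfolding res_units_eq by blast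
  have c: "carrier (units_of R) = {1, 3}" by (simp only: units_of_carrier u)
  have "generate (units_of R) {3} = {1, 3}"
  proof
    show "generate (units_of R) {3} \<subseteq> {1, 3}"
      using group.generate_incl[OF units_group, of "{3}"] unfolding c by blast
    have "\<one>\<^bsub>units_of R\<^esub> = 1" by (simp only: units_of_one res_one_eq)
    then show "{1, 3} \<subseteq> generate (units_of R) {3}"
      using generate.one[of "units_of R" "{3}"] generate.incl[of 3 "{3}" "units_of R"] by auto
  qed
  with c show ?thesis
    unfolding R_def by (simp add: generates_residue_units_def Let_def)
qed

theorem criterion_fails_for_2:
  "\<exists>u \<in> class_B. generates_residue_units (CARD(bool) ^ 2) 3 \<and>
    \<not> ergodic_on_sphere (\<lambda>x :: bool padic_int. x ^ 3 + of_nat CARD(bool) ^ (2 + 1) * u x) 1 2"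
proof (intro bexI conjI three_generates_units_4)
  show "(\<lambda>_. 0) \<in> class_B"
    unfolding class_B_def by (auto intro!: exI[of _ "\<lambda>_. 0"])
qed (use cube_not_ergodic_2 in simp)

end

(*
  On the ball 1 + p^r Z_p the map f satisfies f(x) - f(z) = l (x - z) up to an error smaller than
  x - z by a factor p^2, because r >= 2 and functions in the class B are 1-Lipschitz; moreover
  f(1) = 1 modulo p^(r+1).  If l is not 1 modulo p, then f has an approximate fixed point e in
  1 + p^(r+1) Z_p, and modulo p^(r+2) the j-th iterate is x |-> e + l^j (x - e).  So the orbits on
  the sphere modulo p^(r+2) are the cosets of the subgroup generated by l in the units modulo p^2.

  If f is ergodic, all these orbits coincide, since each is an invariant set of positive measure.
  If l is a generator, then l^(p-1) is not 1 modulo p^2, so the (p-1) p^k-th iterate of f moves every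
  point of the sphere by exactly p^(r+1+k); this makes f transitive modulo every power of p.  Being
  also an isometry, f permutes the balls of each radius cyclically, so the normalized Haar measure is
  the only invariant probability measure, hence ergodic.
*)
theory Submission
  imports Defs
begin


section \<open>Generators of unit groups\<close>

text \<open>In a finite group the subgroup generated by one element consists of its natural-number
  powers. This turns the group-theoretic notion into congruences of natural numbers, the form used
  in both directions of the criterion.\<close>

lemma generates_residue_units_iff:
  assumes "n > 1"
  shows "generates_residue_units n g \<longleftrightarrow>
    coprime g n \<and> (\<forall>c. coprime c n \<longrightarrow> (\<exists>k. [g ^ k = c] (mod n)))"
proof -
  define R where "R = residue_ring (int n)"
  interpret residues "int n" R
    using assms by unfold_locales (simp_all add: R_def)
  let ?h = "int g mod int n"
  interpret U: group "units_of R" by (rule units_group)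
  have carr: "carrier (units_of R) = {x. 0 < x \<and> x < int n \<and> coprime x (int n)}"
    by (simp add: units_of_carrier res_units_eq)
  have fin: "finite (carrier (units_of R))" by (simp add: units_of_carrier)
  have cop_mod: "coprime (int c mod int n) (int n) \<longleftrightarrow> coprime c n" for c
    using assms by (subst coprime_mod_left_iff) simp_all
  have mem: "int c mod int n \<in> carrier (units_of R) \<longleftrightarrow> coprime c n" for c
  proof
    assume c: "coprime c n"
    have "int c mod int n \<noteq> 0"
      using cop_mod[of c] c assms by (auto simp del: coprime_mod_left_iff)
    moreover have "0 \<le> int c mod int n" "int c mod int n < int n" using assms by auto
    ultimately show "int c mod int n \<in> carrier (units_of R)"
      unfolding carr mem_Collect_eq cop_mod using c by linarith
  qed (unfold carr mem_Collect_eq cop_mod, blast)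
  have pow: "?h [^]\<^bsub>units_of R\<^esub> k = int (g ^ k) mod int n" if "coprime g n" for k :: nat
  proof -
    have "?h \<in> Units R" using that mem[of g] unfolding units_of_carrier by blast
    then show ?thesis by (simp only: units_of_pow pow_cong of_nat_power)
  qed
  have "generate (units_of R) {?h} = carrier (units_of R) \<longleftrightarrow>
      (\<forall>c. coprime c n \<longrightarrow> (\<exists>k. [g ^ k = c] (mod n)))" if g: "coprime g n"
  proof -
    have h: "?h \<in> carrier (units_of R)" using g mem by blast
    have gen: "generate (units_of R) {?h} = range (\<lambda>k. int (g ^ k) mod int n)"
      unfolding U.generate_pow_on_finite_carrier[OF fin h] pow[OF g] by blast
    have sub: "generate (units_of R) {?h} \<subseteq> carrier (units_of R)"
      using h by (intro U.generate_incl) blast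
    have cong: "[g ^ k = c] (mod n) \<longleftrightarrow> int (g ^ k) mod int n = int c mod int n" for k c
      by (simp only: cong_int_iff[symmetric] cong_def)
    show ?thesis
    proof
      assume eq: "generate (units_of R) {?h} = carrier (units_of R)"
      show "\<forall>c. coprime c n \<longrightarrow> (\<exists>k. [g ^ k = c] (mod n))"
      proof (intro allI impI)
        fix c assume "coprime c n"
        then have "int c mod int n \<in> range (\<lambda>k. int (g ^ k) mod int n)"
          unfolding gen[symmetric] eq mem .
        then show "\<exists>k. [g ^ k = c] (mod n)" unfolding cong by (elim imageE) (rule exI, rule sym)
      qed
    next
      assume R: "\<forall>c. coprime c n \<longrightarrow> (\<exists>k. [g ^ k = c] (mod n))"
      have "x \<in> generate (units_of R) {?h}" if x: "x \<in> carrier (units_of R)" for x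
      proof -
        have x': "int (nat x) mod int n = x" using x unfolding carr by simp
        then have "coprime (nat x) n" using x mem[of "nat x"] by simp
        then obtain k where "[g ^ k = nat x] (mod n)" using R by blast
        then have "x = int (g ^ k) mod int n" unfolding cong x' by (rule sym)
        then show ?thesis unfolding gen by (rule range_eqI)
      qed
      then show "generate (units_of R) {?h} = carrier (units_of R)" using sub by blast
    qed
  qed
  moreover have "generates_residue_units n g \<longleftrightarrow> ?h \<in> carrier (units_of R) \<and>
      generate (units_of R) {?h} = carrier (units_of R)"
    by (simp only: generates_residue_units_def Let_def R_def)
  ultimately show ?thesis using mem[of g] by metis
qed

text \<open>Orbits that meet yield a congruence with powers of \<open>g\<close> on both sides. By
  Euler's theorem \<open>g ^ (i * (totient n - 1))\<close> is an inverse of \<open>g ^ i\<close>, so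
  the power on the left can be moved across.\<close>

lemma generates_residue_unitsI:
  assumes "n > 1" "coprime g n"
    and "\<And>c. coprime c n \<Longrightarrow> \<exists>i j. [g ^ i * c = g ^ j] (mod n)"
  shows "generates_residue_units n g"
proof -
  have "\<exists>k. [g ^ k = c] (mod n)" if c: "coprime c n" for c
  proof -
    obtain i j where ij: "[g ^ i * c = g ^ j] (mod n)" using assms(3)[OF c] by blast
    have one: "[g ^ (i * totient n) = 1] (mod n)"
      using cong_pow[OF euler_theorem[OF assms(2)], of i] by (metis mult.commute power_mult power_one)
    have "0 < totient n" using assms(1) by simp
    then have t: "i * totient n = i * (totient n - 1) + i" by (cases "totient n") auto
    have "[g ^ (i * (totient n - 1)) * (g ^ i * c) = g ^ (i * (totient n - 1)) * g ^ j] (mod n)"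
      using ij by (rule cong_scalar_left)
    moreover have "g ^ (i * (totient n - 1)) * (g ^ i * c) = g ^ (i * totient n) * c"
      unfolding t power_add by (simp add: mult.assoc)
    moreover have "[g ^ (i * totient n) * c = 1 * c] (mod n)"
      using one by (rule cong_scalar_right)
    ultimately have "[g ^ (i * (totient n - 1) + j) = c] (mod n)"
      by (metis cong_sym cong_trans mult_1 power_add)
    then show ?thesis by blast
  qed
  then show ?thesis using generates_residue_units_iff[OF assms(1)] assms(2) by blast
qed

text \<open>Modulo p^2 the binomial expansion stops after the linear term, which leaves 1 + (p - 1)
  p. So \<open>1 + p\<close> is a unit whose order does not divide p - 1.\<close>

lemma one_plus_prime_power_ne:
  assumes "prime (p :: nat)"
  shows "\<not> [(1 + p) ^ (p - 1) = 1] (mod p\<^sup>2)"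
proof
  assume a: "[(1 + p) ^ (p - 1) = 1] (mod p\<^sup>2)"
  have p: "1 < p" using assms prime_gt_1_nat by blast
  have "[(1 + p) ^ k = 1 + k * p] (mod p\<^sup>2)" for k
  proof (induction k)
    case (Suc k)
    have "[(1 + p) ^ k * (1 + p) = (1 + k * p) * (1 + p)] (mod p\<^sup>2)"
      using Suc.IH by (rule cong_scalar_right)
    moreover have "(1 + k * p) * (1 + p) = 1 + Suc k * p + k * p\<^sup>2"
      by (simp add: algebra_simps power2_eq_square)
    moreover have "[1 + Suc k * p + k * p\<^sup>2 = 1 + Suc k * p] (mod p\<^sup>2)"
      by (simp add: cong_def)
    ultimately show ?case by (metis cong_trans mult.commute power_Suc)
  qed simp
  then have "[1 + (p - 1) * p = 1] (mod p\<^sup>2)" using a cong_sym cong_trans by blast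
  then have "p\<^sup>2 dvd (p - 1) * p" by (metis cong_0_iff cong_add_lcancel_0_nat)
  then have "p dvd p - 1" using p by (simp add: power2_eq_square)
  then show False using p by (simp add: nat_dvd_not_less)
qed

text \<open>Otherwise all powers of \<open>g\<close>, hence all units, would have (p - 1)-th power
  1, which fails for \<open>1 + p\<close>.\<close>

lemma generator_power_ne:
  assumes p: "prime p" and g: "generates_residue_units (p\<^sup>2) g"
  shows "\<not> [g ^ (p - 1) = 1] (mod p\<^sup>2)"
proof
  assume one: "[g ^ (p - 1) = 1] (mod p\<^sup>2)"
  have p1: "1 < p" using p prime_gt_1_nat by blast
  have "coprime (1 + p) (p\<^sup>2)" by simp
  then obtain k where "[g ^ k = 1 + p] (mod p\<^sup>2)"
    using g generates_residue_units_iff[OF one_less_power[OF p1 pos2]] by blast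
  then have "[(g ^ k) ^ (p - 1) = (1 + p) ^ (p - 1)] (mod p\<^sup>2)" by (rule cong_pow)
  moreover have "[(g ^ k) ^ (p - 1) = 1] (mod p\<^sup>2)"
    using cong_pow[OF one, of k] by (metis mult.commute power_mult power_one)
  ultimately show False
    using one_plus_prime_power_ne[OF p] cong_sym cong_trans by blast
qed


section \<open>Congruences of p-adic integers\<close>

abbreviation uniformizer :: "'p::prime_card padic_int" ("\<varpi>") where
  "\<varpi> \<equiv> of_nat CARD('p)"

lemma uniformizer_neq_0 [simp]: "\<varpi> \<noteq> (0 :: 'p::prime_card padic_int)"
  using prime_card[where 'a='p] by (simp add: prime_gt_0_nat)

lemma uniformizer_power_dvd_of_int:
  "\<varpi> ^ n dvd (of_int a :: 'p::prime_card padic_int) \<longleftrightarrow> int CARD('p) ^ n dvd a"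
  by (simp add: p_pow_dvd_iff residue_of_int mod_eq_0_iff_dvd)

lemma uniformizer_power_dvd_diff_of_nat:
  "\<varpi> ^ n dvd (of_nat a - of_nat b :: 'p::prime_card padic_int) \<longleftrightarrow> [a = b] (mod CARD('p) ^ n)"
proof -
  have "(of_nat a - of_nat b :: 'p padic_int) = of_int (int a - int b)" by simp
  then show ?thesis
    unfolding uniformizer_power_dvd_of_int
    by (simp only: uniformizer_power_dvd_of_int cong_int_iff[symmetric] cong_iff_dvd_diff of_nat_power)
qed

lemma exists_cong_of_nat:
  obtains a where "a < CARD('p) ^ n" "\<varpi> ^ n dvd (x - of_nat a :: 'p::prime_card padic_int)"
proof
  show "nat (residue x n) < CARD('p) ^ n"
    using residue_range[of x n] by (simp add: nat_less_iff)
  show "\<varpi> ^ n dvd x - of_nat (nat (residue x n))"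
    using residue_range(1)[of x n]
    by (simp add: p_pow_dvd_iff residue_diff_eq_0_iff residue_of_int)
qed

lemma uniformizer_dvd_mult_iff:
  "\<varpi> dvd x * y \<longleftrightarrow> \<varpi> dvd x \<or> \<varpi> dvd (y :: 'p::prime_card padic_int)"
proof
  assume "\<varpi> dvd x * y"
  then have "int CARD('p) dvd residue x 1 * residue y 1"
    using p_pow_dvd_iff[of 1 "x * y"] by (simp add: times_padic_int.rep_eq mod_eq_0_iff_dvd)
  then have "int CARD('p) dvd residue x 1 \<or> int CARD('p) dvd residue y 1"
    using prime_card[where 'a='p] by (simp add: prime_dvd_mult_iff)
  moreover have "residue z 1 = 0" if "int CARD('p) dvd residue z 1" for z :: "'p padic_int"
    using residue_mod[of z 1] that by simp
  ultimately show "\<varpi> dvd x \<or> \<varpi> dvd y"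
    using p_pow_dvd_iff[of 1 x] p_pow_dvd_iff[of 1 y] by auto
qed auto

lemma unit_iff_not_uniformizer_dvd: "x dvd 1 \<longleftrightarrow> \<not> \<varpi> dvd (x :: 'p::prime_card padic_int)"
proof
  assume "x dvd 1"
  moreover have "residue (1 :: 'p padic_int) 1 \<noteq> 0"
    using p_gt_1[where 'p='p] by (simp add: one_padic_int.rep_eq)
  then have "\<not> \<varpi> ^ 1 dvd (1 :: 'p padic_int)" unfolding p_pow_dvd_iff .
  ultimately show "\<not> \<varpi> dvd x" using dvd_trans by (metis power_one_right)
next
  assume "\<not> \<varpi> dvd x"
  then show "x dvd 1" using padic_unit[of x] p_pow_dvd_iff[of 1 x] by simp
qed

lemma uniformizer_power_dvd_mult_unit:
  assumes "\<not> \<varpi> dvd (L :: 'p::prime_card padic_int)"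
  shows "\<varpi> ^ n dvd L * x \<longleftrightarrow> \<varpi> ^ n dvd x"
  using assms by (simp add: dvd_mult_unit_iff' unit_iff_not_uniformizer_dvd[symmetric])

lemma mem_padic_sphere_iff:
  "x \<in> padic_sphere y r \<longleftrightarrow> \<varpi> ^ r dvd x - y \<and> \<not> \<varpi> ^ Suc r dvd (x - y :: 'p::prime_card padic_int)"
  unfolding padic_sphere_def p_pow_dvd_iff using padic_norm_eq_iff[of "x - y" r] by simp

section \<open>Congruences between series, and the class B\<close>

text \<open>Divisibility by \<open>\<varpi> ^ n\<close> means norm at most p^(-n), so each limit is
  congruent to all its late partial sums, and these are congruent term by term.\<close>

lemma sums_cong_padic:
  fixes f g :: "nat \<Rightarrow> 'p::prime_card padic_int"
  assumes "f sums a" "g sums b" "\<And>i. \<varpi> ^ n dvd f i - g i"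
  shows "\<varpi> ^ n dvd a - b"
proof -
  have partial: "\<forall>\<^sub>F N in sequentially. \<varpi> ^ n dvd (\<Sum>i<N. h i) - s" if "h sums s"
    for h and s :: "'p padic_int"
  proof -
    have "0 < 1 / real CARD('p) ^ n" using p_gt_1[where 'p='p] by simp
    from tendstoD[OF that[unfolded sums_def] this]
    show ?thesis
      by eventually_elim (simp add: dist_padic_int_def p_pow_dvd_iff padic_norm_le_iff[symmetric])
  qed
  obtain N where "\<varpi> ^ n dvd (\<Sum>i<N. f i) - a" "\<varpi> ^ n dvd (\<Sum>i<N. g i) - b"
    using eventually_happens'[OF _ eventually_conj[OF partial[OF assms(1)] partial[OF assms(2)]]]
    by auto
  moreover have "\<varpi> ^ n dvd (\<Sum>i<N. f i) - (\<Sum>i<N. g i)"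
    unfolding sum_subtractf[symmetric] by (rule dvd_sum) (rule assms(3))
  moreover have "a - b = ((\<Sum>i<N. f i) - (\<Sum>i<N. g i)) - ((\<Sum>i<N. f i) - a) + ((\<Sum>i<N. g i) - b)"
    by simp
  ultimately show ?thesis by (metis dvd_add dvd_diff)
qed

text \<open>The factor \<open>fact i\<close> of \<open>a i\<close> cancels the denominator of the
  binomial coefficient. Each term is then a p-adic integer times a product of factors
  \<open>x - of_nat j\<close>, and such products preserve congruences.\<close>

lemma class_B_lipschitz:
  fixes u :: "'p::prime_card padic_int \<Rightarrow> 'p padic_int"
  assumes "u \<in> class_B" "\<varpi> ^ n dvd x - y"
  shows "\<varpi> ^ n dvd u x - u y"
proof -
  obtain a where a: "\<And>i. fact i dvd a i" "\<And>x. (\<lambda>i. a i * padic_binomial x i) sums u x"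
    using assms(1) unfolding class_B_def by blast
  have "\<varpi> ^ n dvd a i * padic_binomial x i - a i * padic_binomial y i" for i
  proof -
    obtain c where c: "a i = fact i * c" using a(1) by blast
    have "residue x n = residue y n"
      using assms(2) by (simp add: p_pow_dvd_iff residue_diff_eq_0_iff)
    then have "residue (\<Prod>j\<in>A. x - of_nat j) n = residue (\<Prod>j\<in>A. y - of_nat j) n" for A
      by (induction A rule: infinite_finite_induct) (simp_all add: residue_simps)
    then have "\<varpi> ^ n dvd (\<Prod>j=0..<i. x - of_nat j) - (\<Prod>j=0..<i. y - of_nat j)"
      by (simp add: p_pow_dvd_iff residue_diff_eq_0_iff)
    moreover have "a i * padic_binomial x i - a i * padic_binomial y i
        = c * ((\<Prod>j=0..<i. x - of_nat j) - (\<Prod>j=0..<i. y - of_nat j))"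
      unfolding c fact_mult_padic_binomial[symmetric] by (simp add: algebra_simps)
    ultimately show ?thesis by simp
  qed
  then show ?thesis by (rule sums_cong_padic[OF a(2) a(2)])
qed

section \<open>Maps that are affine to second order\<close>

text \<open>
  The exponent \<open>n + 2\<close> is what makes sums of \<open>p\<close> successive displacements computable to relative
  precision \<open>p\<^sup>2\<close>, which is enough to read off their exact valuation.
\<close>

definition near_affine ::
    "nat \<Rightarrow> 'p::prime_card padic_int \<Rightarrow> ('p padic_int \<Rightarrow> 'p padic_int) \<Rightarrow> bool" where
  "near_affine r L F \<longleftrightarrow> \<varpi> ^ r dvd F 1 - 1 \<and>
    (\<forall>x y n. \<varpi> ^ r dvd x - 1 \<longrightarrow> \<varpi> ^ r dvd y - 1 \<longrightarrow> \<varpi> ^ n dvd x - y \<longrightarrow>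
      \<varpi> ^ (n + 2) dvd F x - F y - L * (x - y))"

lemma near_affineD:
  assumes "near_affine r L F" "\<varpi> ^ r dvd x - 1" "\<varpi> ^ r dvd y - 1" "\<varpi> ^ n dvd x - y"
  shows "\<varpi> ^ (n + 2) dvd F x - F y - L * (x - y)"
  using assms unfolding near_affine_def by blast

lemma near_affine_dvd_diff:
  assumes "near_affine r L F" "\<varpi> ^ r dvd x - 1" "\<varpi> ^ r dvd y - 1" "\<varpi> ^ n dvd x - y"
  shows "\<varpi> ^ n dvd F x - F y"
proof -
  have "\<varpi> ^ n dvd F x - F y - L * (x - y)"
    using near_affineD[OF assms] by (rule power_le_dvd) simp
  then have "\<varpi> ^ n dvd (F x - F y - L * (x - y)) + L * (x - y)"
    using assms(4) by (intro dvd_add) auto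
  then show ?thesis by simp
qed

text \<open>For the forward direction the divisibility of \<open>x - y\<close> is raised one power
  at a time: if \<open>\<varpi> ^ m\<close> divides it, the affine error is divisible by
  \<open>\<varpi> ^ (m + 2)\<close>, so \<open>L * (x - y)\<close> inherits one more factor from
  \<open>F x - F y\<close>, and \<open>L\<close> is a unit.\<close>

lemma near_affine_isometric:
  fixes L :: "'p::prime_card padic_int"
  assumes F: "near_affine r L F" and L: "\<not> \<varpi> dvd L"
    and x: "\<varpi> ^ r dvd x - 1" and y: "\<varpi> ^ r dvd y - 1"
  shows "\<varpi> ^ n dvd F x - F y \<longleftrightarrow> \<varpi> ^ n dvd x - y"
proof
  assume n: "\<varpi> ^ n dvd F x - F y"
  have "m \<le> n \<Longrightarrow> \<varpi> ^ m dvd x - y" for m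
  proof (induction m)
    case (Suc m)
    then have "\<varpi> ^ (m + 2) dvd F x - F y - L * (x - y)" by (intro near_affineD[OF F x y]) simp
    then have 1: "\<varpi> ^ Suc m dvd F x - F y - L * (x - y)" by (rule power_le_dvd) simp
    have "\<varpi> ^ Suc m dvd F x - F y" using n Suc.prems by (rule power_le_dvd)
    from dvd_diff[OF this 1] have "\<varpi> ^ Suc m dvd L * (x - y)" by simp
    then show ?case unfolding uniformizer_power_dvd_mult_unit[OF L] .
  qed simp
  then show "\<varpi> ^ n dvd x - y" by simp
qed (rule near_affine_dvd_diff[OF F x y])

lemma near_affine_ball:
  assumes "near_affine r L F" "\<varpi> ^ r dvd x - 1"
  shows "\<varpi> ^ r dvd F x - 1"
proof -
  have "\<varpi> ^ r dvd (F x - F 1) + (F 1 - 1)"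
    using near_affine_dvd_diff[OF assms, of 1 r] assms unfolding near_affine_def
    by (intro dvd_add) auto
  then show ?thesis by simp
qed

text \<open>This is the chain rule. \<open>G\<close> does not lower the divisibility of differences,
  so the error of \<open>F\<close> at the images is still small enough.\<close>

lemma near_affine_compose:
  assumes F: "near_affine r L F" and G: "near_affine r M G"
  shows "near_affine r (L * M) (\<lambda>x. F (G x))"
  unfolding near_affine_def
proof (intro conjI allI impI)
  have "\<varpi> ^ r dvd G 1 - 1" using G near_affine_def by blast
  then show "\<varpi> ^ r dvd F (G 1) - 1" by (rule near_affine_ball[OF F])
next
  fix x y :: "'a padic_int" and n
  assume x: "\<varpi> ^ r dvd x - 1" and y: "\<varpi> ^ r dvd y - 1" and xy: "\<varpi> ^ n dvd x - y"
  have "\<varpi> ^ (n + 2) dvd F (G x) - F (G y) - L * (G x - G y)"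
    using near_affineD[OF F near_affine_ball[OF G x] near_affine_ball[OF G y]
        near_affine_dvd_diff[OF G x y xy]] .
  moreover have "\<varpi> ^ (n + 2) dvd L * (G x - G y - M * (x - y))"
    using near_affineD[OF G x y xy] by (rule dvd_mult)
  ultimately have "\<varpi> ^ (n + 2) dvd
      (F (G x) - F (G y) - L * (G x - G y)) + L * (G x - G y - M * (x - y))" by (rule dvd_add)
  then show "\<varpi> ^ (n + 2) dvd F (G x) - F (G y) - L * M * (x - y)" by (simp add: algebra_simps)
qed

lemma near_affine_funpow:
  assumes "near_affine r L F"
  shows "near_affine r (L ^ k) (F ^^ k)"
proof (induction k)
  case 0
  then show ?case by (simp add: near_affine_def)
next
  case (Suc k)
  then show ?case using near_affine_compose[OF assms Suc.IH] by (simp add: comp_def)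
qed

text \<open>The difference of the powers factors as \<open>(x - y) * S\<close>, and every summand of
  \<open>S\<close> is 1 modulo \<open>\<varpi> ^ r\<close>, so \<open>S\<close> is close to the
  derivative \<open>l\<close> at 1. The perturbation only adds to the error.\<close>

lemma near_affine_perturbed_monomial:
  fixes u :: "'p::prime_card padic_int \<Rightarrow> 'p padic_int"
  assumes r: "r \<ge> 2"
    and u: "\<And>n x y. \<varpi> ^ n dvd x - y \<Longrightarrow> \<varpi> ^ n dvd u x - u y"
  shows "near_affine r (of_nat l) (\<lambda>x. x ^ l + \<varpi> ^ (r + 1) * u x)"
  unfolding near_affine_def
proof (intro conjI allI impI)
  show "\<varpi> ^ r dvd 1 ^ l + \<varpi> ^ (r + 1) * u 1 - 1" by simp
next
  fix x y :: "'p padic_int" and n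
  assume x: "\<varpi> ^ r dvd x - 1" and y: "\<varpi> ^ r dvd y - 1" and xy: "\<varpi> ^ n dvd x - y"
  define S where "S = (\<Sum>i<l. y ^ (l - Suc i) * x ^ i)"
  have pow: "\<varpi> ^ r dvd z ^ i - 1" if "\<varpi> ^ r dvd z - 1" for z :: "'p padic_int" and i
    using that by (simp add: power_diff_1_eq)
  have "\<varpi> ^ r dvd (\<Sum>i<l. y ^ (l - Suc i) * x ^ i - 1)"
  proof (rule dvd_sum)
    fix i
    have "\<varpi> ^ r dvd y ^ (l - Suc i) * (x ^ i - 1) + (y ^ (l - Suc i) - 1)"
      using pow[OF x] pow[OF y] by (intro dvd_add dvd_mult)
    then show "\<varpi> ^ r dvd y ^ (l - Suc i) * x ^ i - 1" by (simp add: algebra_simps)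
  qed
  then have "\<varpi> ^ r dvd S - of_nat l" by (simp add: S_def sum_subtractf)
  \<comment> \<open>Here \<open>r \<ge> 2\<close> supplies the relative precision p^2.\<close>
  then have "\<varpi> ^ 2 dvd S - of_nat l" using r by (rule power_le_dvd)
  then have 1: "\<varpi> ^ (n + 2) dvd (x - y) * (S - of_nat l)"
    unfolding power_add using xy by (rule mult_dvd_mono[rotated])
  have "\<varpi> ^ (n + (r + 1)) dvd (u x - u y) * \<varpi> ^ (r + 1)"
    unfolding power_add[of _ n "r + 1"] using u[OF xy] by (rule mult_dvd_mono) simp
  then have 2: "\<varpi> ^ (n + 2) dvd (u x - u y) * \<varpi> ^ (r + 1)"
    using r by (elim power_le_dvd) simp
  have "x ^ l - y ^ l = (x - y) * S"
    unfolding S_def by (rule power_diff_sumr2)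
  then have "x ^ l + \<varpi> ^ (r + 1) * u x - (y ^ l + \<varpi> ^ (r + 1) * u y) - of_nat l * (x - y)
      = (x - y) * (S - of_nat l) + (u x - u y) * \<varpi> ^ (r + 1)"
    by (simp add: algebra_simps)
  then show "\<varpi> ^ (n + 2) dvd
      x ^ l + \<varpi> ^ (r + 1) * u x - (y ^ l + \<varpi> ^ (r + 1) * u y) - of_nat l * (x - y)"
    using 1 2 by (metis dvd_add)
qed


section \<open>Orbits on the sphere\<close>

text \<open>Successive displacements are multiplied by \<open>L\<close>, which is 1 modulo p. To
  first order they are all equal, so the displacement after \<open>i\<close> steps is
  \<open>i\<close> times the first one.\<close>

lemma near_affine_drift:
  fixes L :: "'p::prime_card padic_int"
  assumes G: "near_affine r L G" and L: "\<varpi> dvd L - 1" and x: "\<varpi> ^ r dvd x - 1"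
    and m: "\<varpi> ^ m dvd G x - x"
  shows "\<varpi> ^ (m + 1) dvd (G ^^ i) x - x - of_nat i * (G x - x)"
proof (induction i)
  case (Suc i)
  have "\<varpi> ^ (m + 2) dvd (G ^^ i) (G x) - (G ^^ i) x - L ^ i * (G x - x)"
    by (rule near_affineD[OF near_affine_funpow[OF G] near_affine_ball[OF G x] x m])
  then have 1: "\<varpi> ^ (m + 1) dvd (G ^^ i) (G x) - (G ^^ i) x - L ^ i * (G x - x)"
    by (rule power_le_dvd) simp
  have "\<varpi> dvd L ^ i - 1" using L by (simp add: power_diff_1_eq)
  then have 2: "\<varpi> ^ (m + 1) dvd (L ^ i - 1) * (G x - x)"
    using mult_dvd_mono[OF _ m, of \<varpi> "L ^ i - 1"] by simp
  have eq: "(G ^^ Suc i) x - x - of_nat (Suc i) * (G x - x)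
      = ((G ^^ i) (G x) - (G ^^ i) x - L ^ i * (G x - x)) + (L ^ i - 1) * (G x - x)
        + ((G ^^ i) x - x - of_nat i * (G x - x))"
    by (simp add: funpow_swap1 algebra_simps)
  show ?case unfolding eq by (rule dvd_add[OF dvd_add[OF 1 2] Suc.IH])
qed simp

text \<open>Modulo p^2 the power \<open>L ^ i\<close> is 1 + i (L - 1). Summing i over i < p gives p
  (p - 1) / 2, which for odd p is a multiple of p; together with the factor p of
  \<open>L - 1\<close> the linear terms vanish modulo p^2.\<close>

lemma sum_powers_cong:
  fixes L :: "'p::prime_card padic_int"
  assumes p: "CARD('p) \<noteq> 2" and L: "\<varpi> dvd L - 1"
  shows "\<varpi> ^ 2 dvd (\<Sum>i<CARD('p). L ^ i) - \<varpi>"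
proof -
  have pow: "\<varpi> ^ 2 dvd L ^ i - 1 - of_nat i * (L - 1)" for i
  proof (induction i)
    case (Suc i)
    have "\<varpi> dvd L ^ i - 1" using L by (simp add: power_diff_1_eq)
    then have "\<varpi> ^ 2 dvd (L ^ i - 1) * (L - 1)"
      unfolding power2_eq_square using L by (rule mult_dvd_mono)
    with Suc.IH have "\<varpi> ^ 2 dvd (L ^ i - 1 - of_nat i * (L - 1)) + (L ^ i - 1) * (L - 1)"
      by (rule dvd_add)
    then show ?case by (simp add: algebra_simps)
  qed simp
  have "odd CARD('p)"
    using p prime_card[where 'a='p] prime_ge_2_nat[of "CARD('p)"] by (intro prime_odd_nat) linarith+
  then obtain h where h: "CARD('p) = 2 * h + 1" by (rule oddE)
  \<comment> \<open>Taking \<open>k = 2 * h\<close> and cancelling 2 exhibits the factor p.\<close>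
  have "(\<Sum>i<Suc k. i) * 2 = Suc k * k" for k :: nat
    by (induction k) auto
  from this[of "2 * h"] have "(\<Sum>i<CARD('p). i) = CARD('p) * h" unfolding h by simp
  then have "(\<Sum>i<CARD('p). of_nat i) = (\<varpi> * of_nat h :: 'p padic_int)"
    by (simp only: of_nat_sum[symmetric] of_nat_mult)
  then have "(\<Sum>i<CARD('p). of_nat i * (L - 1)) = \<varpi> * (L - 1) * of_nat h"
    by (simp add: sum_distrib_right[symmetric])
  moreover have "\<varpi> ^ 2 dvd \<varpi> * (L - 1) * of_nat h"
    unfolding power2_eq_square using L by (intro dvd_mult2 mult_dvd_mono) auto
  moreover have "\<varpi> ^ 2 dvd (\<Sum>i<CARD('p). L ^ i - 1 - of_nat i * (L - 1))"
    by (intro dvd_sum pow)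
  ultimately have "\<varpi> ^ 2 dvd (\<Sum>i<CARD('p). L ^ i - 1 - of_nat i * (L - 1))
      + (\<Sum>i<CARD('p). of_nat i * (L - 1))" by (simp only: dvd_add)
  moreover have "(\<Sum>i<n. L ^ i - 1 - of_nat i * (L - 1)) + (\<Sum>i<n. of_nat i * (L - 1))
      = (\<Sum>i<n. L ^ i) - of_nat n" for n
    by (simp add: sum_subtractf)
  ultimately show ?thesis by (simp only:)
qed

text \<open>The displacements telescope to a geometric sum in \<open>L\<close> times the first
  displacement, and by \<open>sum_powers_cong\<close> this sum may be replaced by p. The relative
  precision is p^2, one power better than in \<open>near_affine_drift\<close>.\<close>

lemma near_affine_funpow_prime:
  fixes L :: "'p::prime_card padic_int"
  assumes p: "CARD('p) \<noteq> 2" and G: "near_affine r L G" and L: "\<varpi> dvd L - 1"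
    and x: "\<varpi> ^ r dvd x - 1" and m: "\<varpi> ^ m dvd G x - x"
  shows "\<varpi> ^ (m + 2) dvd (G ^^ CARD('p)) x - x - \<varpi> * (G x - x)"
proof -
  have "\<varpi> ^ (m + 2) dvd (G ^^ k) x - x - (\<Sum>i<k. L ^ i) * (G x - x)" for k
  proof (induction k)
    case (Suc k)
    have "\<varpi> ^ (m + 2) dvd (G ^^ k) (G x) - (G ^^ k) x - L ^ k * (G x - x)"
      by (rule near_affineD[OF near_affine_funpow[OF G] near_affine_ball[OF G x] x m])
    from dvd_add[OF this Suc.IH] show ?case by (simp add: funpow_swap1 algebra_simps)
  qed simp
  moreover have "\<varpi> ^ (m + 2) dvd ((\<Sum>i<CARD('p). L ^ i) - \<varpi>) * (G x - x)"
    using mult_dvd_mono[OF sum_powers_cong[OF p L] m] by (simp only: power_add mult.commute[of "\<varpi> ^ m"])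
  ultimately have "\<varpi> ^ (m + 2) dvd ((G ^^ CARD('p)) x - x - (\<Sum>i<CARD('p). L ^ i) * (G x - x))
      + ((\<Sum>i<CARD('p). L ^ i) - \<varpi>) * (G x - x)" by (rule dvd_add)
  then show ?thesis by (simp add: algebra_simps)
qed

text \<open>The main term \<open>\<varpi> * (G x - x)\<close> has valuation exactly
  \<open>m + 1\<close> and the error has valuation at least \<open>m + 2\<close>, so the main term
  decides.\<close>

lemma near_affine_funpow_prime_exact:
  fixes L :: "'p::prime_card padic_int"
  assumes p: "CARD('p) \<noteq> 2" and G: "near_affine r L G" and L: "\<varpi> dvd L - 1"
    and x: "\<varpi> ^ r dvd x - 1" and m: "\<varpi> ^ m dvd G x - x" "\<not> \<varpi> ^ Suc m dvd G x - x"
  shows "\<varpi> ^ Suc m dvd (G ^^ CARD('p)) x - x" "\<not> \<varpi> ^ Suc (Suc m) dvd (G ^^ CARD('p)) x - x"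
proof -
  have d: "\<varpi> ^ Suc (Suc m) dvd (G ^^ CARD('p)) x - x - \<varpi> * (G x - x)"
    using near_affine_funpow_prime[OF p G L x m(1)] by simp
  have "\<varpi> ^ Suc m dvd \<varpi> * (G x - x)" using m(1) by simp
  moreover have "\<varpi> ^ Suc m dvd (G ^^ CARD('p)) x - x - \<varpi> * (G x - x)"
    using d by (rule power_le_dvd) simp
  ultimately have "\<varpi> ^ Suc m dvd
      ((G ^^ CARD('p)) x - x - \<varpi> * (G x - x)) + \<varpi> * (G x - x)" by (intro dvd_add)
  then show "\<varpi> ^ Suc m dvd (G ^^ CARD('p)) x - x" by simp
  show "\<not> \<varpi> ^ Suc (Suc m) dvd (G ^^ CARD('p)) x - x"
  proof
    assume "\<varpi> ^ Suc (Suc m) dvd (G ^^ CARD('p)) x - x"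
    then have "\<varpi> ^ Suc (Suc m) dvd
        (G ^^ CARD('p)) x - x - ((G ^^ CARD('p)) x - x - \<varpi> * (G x - x))"
      using d by (rule dvd_diff)
    then have "\<varpi> * \<varpi> ^ Suc m dvd \<varpi> * (G x - x)" by simp
    then show False using m(2) by (simp only: dvd_mult_cancel_left) simp
  qed
qed

section \<open>Linearization of the iterates on the sphere\<close>

text \<open>The point 1 is fixed modulo \<open>\<varpi> ^ (r + 1)\<close>, so it serves as a centre
  for all iterates. On the sphere this precision determines just the leading digit of
  \<open>x - 1\<close>.\<close>

lemma near_affine_linear:
  assumes f: "near_affine r L f" and f1: "\<varpi> ^ (r + 1) dvd f 1 - (1 :: 'p::prime_card padic_int)"
    and x: "\<varpi> ^ r dvd x - 1"
  shows "\<varpi> ^ (r + 1) dvd (f ^^ j) x - 1 - L ^ j * (x - 1)"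
proof -
  have fj: "\<varpi> ^ (r + 1) dvd (f ^^ j) 1 - 1"
  proof (induction j)
    case (Suc j)
    have "\<varpi> ^ r dvd (f ^^ j) 1 - 1" using Suc.IH by (rule power_le_dvd) simp
    then have "\<varpi> ^ (r + 1) dvd f ((f ^^ j) 1) - f 1"
      using near_affine_dvd_diff[OF f _ _ Suc.IH] by simp
    from dvd_add[OF this f1] show ?case by simp
  qed simp
  have "\<varpi> ^ (r + 2) dvd (f ^^ j) x - (f ^^ j) 1 - L ^ j * (x - 1)"
    using near_affineD[OF near_affine_funpow[OF f] x _ x] by simp
  then have "\<varpi> ^ (r + 1) dvd (f ^^ j) x - (f ^^ j) 1 - L ^ j * (x - 1)"
    by (rule power_le_dvd) simp
  from dvd_add[OF this fj] show ?thesis by (simp add: algebra_simps)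
qed

lemma near_affine_sphere:
  assumes f: "near_affine r L f" and f1: "\<varpi> ^ (r + 1) dvd f 1 - (1 :: 'p::prime_card padic_int)"
    and L: "\<not> \<varpi> dvd L" and x: "x \<in> padic_sphere 1 r"
  shows "f x \<in> padic_sphere 1 r"
proof -
  have x': "\<varpi> ^ r dvd x - 1" "\<not> \<varpi> ^ (r + 1) dvd x - 1" using x by (auto simp: mem_padic_sphere_iff)
  have "\<varpi> ^ (r + 1) dvd f x - 1 - L * (x - 1)"
    using near_affine_linear[OF f f1 x'(1), of 1] by simp
  then have "\<varpi> ^ (r + 1) dvd f x - 1 \<longleftrightarrow> \<varpi> ^ (r + 1) dvd L * (x - 1)"
    by (metis diff_add_cancel dvd_add_right_iff)
  then show ?thesis
    using x' near_affine_ball[OF f x'(1)] uniformizer_power_dvd_mult_unit[OF L, of "Suc r"]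
    by (simp add: mem_padic_sphere_iff del: power_Suc)
qed

text \<open>One Newton step from 1 gives a centre that is fixed to one digit more, the precision at
  which residues of \<open>l\<close> modulo p^2 become visible on the sphere.\<close>

lemma near_affine_fixed_point:
  assumes f: "near_affine r L f" and f1: "\<varpi> ^ (r + 1) dvd f 1 - (1 :: 'p::prime_card padic_int)"
    and L: "\<not> \<varpi> dvd L - 1"
  obtains e where "\<varpi> ^ (r + 1) dvd e - 1"
    "\<And>j x. \<varpi> ^ r dvd x - 1 \<Longrightarrow> \<varpi> ^ (r + 2) dvd (f ^^ j) x - e - L ^ j * (x - e)"
proof -
  obtain w where w: "f 1 - 1 = \<varpi> ^ (r + 1) * w" using f1 by blast
  obtain v where v: "1 = (L - 1) * v" using L unfolding unit_iff_not_uniformizer_dvd[symmetric] by blast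
  \<comment> \<open>Since \<open>v\<close> is the inverse of \<open>L - 1\<close>, this is the
    solution of the linear equation f 1 - 1 + (L - 1)(e - 1) = 0.\<close>
  define e where "e = 1 - \<varpi> ^ (r + 1) * w * v"
  have e1: "\<varpi> ^ (r + 1) dvd e - 1" by (simp add: e_def)
  then have er: "\<varpi> ^ r dvd e - 1" by (rule power_le_dvd) simp
  have "\<varpi> ^ (r + 3) dvd f e - f 1 - L * (e - 1)"
    using near_affineD[OF f er _ e1] by (simp add: eval_nat_numeral)
  moreover have "f e - f 1 - L * (e - 1) = f e - e - (f 1 - 1 + (L - 1) * (e - 1))"
    by (simp add: algebra_simps)
  moreover have "f 1 - 1 + (L - 1) * (e - 1) = \<varpi> ^ (r + 1) * w * (1 - (L - 1) * v)"
    unfolding w e_def by (simp add: algebra_simps)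
  then have "f 1 - 1 + (L - 1) * (e - 1) = 0" unfolding v[symmetric] by simp
  ultimately have "\<varpi> ^ (r + 3) dvd f e - e" by simp
  then have fe: "\<varpi> ^ (r + 2) dvd f e - e" by (rule power_le_dvd) simp
  have fj: "\<varpi> ^ (r + 2) dvd (f ^^ j) e - e" for j
  proof (induction j)
    case (Suc j)
    have "\<varpi> ^ r dvd (f ^^ j) e - 1"
      by (rule near_affine_ball[OF near_affine_funpow[OF f] er])
    from dvd_add[OF near_affine_dvd_diff[OF f this er Suc.IH] fe] show ?case by simp
  qed simp
  show thesis
  proof (rule that[OF e1])
    fix j and x :: "'p padic_int"
    assume x: "\<varpi> ^ r dvd x - 1"
    have "\<varpi> ^ r dvd x - e" using dvd_diff[OF x er] by simp
    from near_affineD[OF near_affine_funpow[OF f] x er this, of j]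
    show "\<varpi> ^ (r + 2) dvd (f ^^ j) x - e - L ^ j * (x - e)"
      using dvd_add[OF _ fj[of j]] by (fastforce simp: algebra_simps)
  qed
qed

lemma padic_sphere_representation:
  assumes "x \<in> padic_sphere y r"
  obtains a where "x - y = \<varpi> ^ r * a" "\<not> \<varpi> dvd (a :: 'p::prime_card padic_int)"
proof -
  obtain a where a: "x - y = \<varpi> ^ r * a"
    using assms unfolding mem_padic_sphere_iff by (blast elim: dvdE)
  have "\<not> \<varpi> dvd a"
  proof
    assume "\<varpi> dvd a"
    then have "\<varpi> ^ r * \<varpi> dvd x - y" unfolding a by (intro mult_dvd_mono) simp_all
    then show False using assms by (simp add: mem_padic_sphere_iff mult.commute)
  qed
  with a show thesis by (rule that)
qed

text \<open>The residue field has p elements, so the quotient of \<open>b\<close> by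
  \<open>a\<close> modulo p is represented by a natural number, which can serve as a number of
  iterations.\<close>

lemma exists_of_nat_mult_cong:
  fixes a b :: "'p::prime_card padic_int"
  assumes "\<not> \<varpi> dvd a"
  obtains c where "\<varpi> dvd of_nat c * a - b"
proof -
  obtain a' where a': "1 = a * a'" using assms unfolding unit_iff_not_uniformizer_dvd[symmetric] by blast
  obtain c where c: "\<varpi> ^ 1 dvd b * a' - of_nat c" using exists_cong_of_nat[of 1 "b * a'"] by blast
  have "b = b * (a * a')" unfolding a'[symmetric] by simp
  then have "of_nat c * a - b = - ((b * a' - of_nat c) * a)" by (simp add: algebra_simps)
  then show thesis using c by (intro that[of c]) simp
qed

lemma coprime_uniformizer_iff:
  "coprime c (CARD('p) ^ 2) \<longleftrightarrow> \<not> \<varpi> dvd (of_nat c :: 'p::prime_card padic_int)"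
proof -
  have P: "prime CARD('p)" by (rule prime_card)
  have "\<varpi> dvd (of_nat c :: 'p padic_int) \<longleftrightarrow> CARD('p) dvd c"
    using uniformizer_power_dvd_diff_of_nat[of 1 c 0, where 'p='p] by (simp add: cong_0_iff)
  moreover have "coprime c (CARD('p) ^ 2) \<longleftrightarrow> coprime CARD('p) c"
    by (simp add: coprime_commute)
  moreover have "coprime CARD('p) c \<longleftrightarrow> \<not> CARD('p) dvd c"
    by (metis P coprime_common_divisor dvd_refl not_prime_unit prime_imp_coprime)
  ultimately show ?thesis by simp
qed

text \<open>
  One return time \<open>p - 1\<close> moves a point of the sphere by \<open>(l\<^sup>p\<^sup>-\<^sup>1 - 1)(x - e)\<close> modulo \<open>p\<^sup>r\<^sup>+\<^sup>2\<close>, where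
  \<open>e\<close> is the approximate fixed point and \<open>p\<^sup>2\<close> does not divide \<open>l\<^sup>p\<^sup>-\<^sup>1 - 1\<close>; each further \<open>p\<close>-fold
  iteration multiplies the displacement by \<open>p\<close> up to a unit.
\<close>

lemma near_affine_generator_displacement:
  fixes f :: "'p::prime_card padic_int \<Rightarrow> 'p padic_int"
  assumes p: "CARD('p) \<noteq> 2" and f: "near_affine r (of_nat l) f" and f1: "\<varpi> ^ (r + 1) dvd f 1 - 1"
    and g: "generates_residue_units (CARD('p) ^ 2) l" and x: "x \<in> padic_sphere 1 r"
  shows "\<varpi> ^ (r + 1 + k) dvd (f ^^ ((CARD('p) - 1) * CARD('p) ^ k)) x - x \<and>
    \<not> \<varpi> ^ Suc (r + 1 + k) dvd (f ^^ ((CARD('p) - 1) * CARD('p) ^ k)) x - x"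
proof -
  let ?P = "CARD('p)"
  define M where "M = (of_nat l :: 'p padic_int) ^ (?P - 1)"
  have P: "prime ?P" by (rule prime_card)
  have P2: "1 < ?P ^ 2" using P by (intro one_less_power prime_gt_1_nat) simp_all
  have l: "coprime l (?P ^ 2)" and gen: "\<And>c. coprime c (?P ^ 2) \<Longrightarrow> \<exists>k. [l ^ k = c] (mod ?P ^ 2)"
    using g generates_residue_units_iff[OF P2] by auto
  have x': "\<varpi> ^ r dvd x - 1" "\<not> \<varpi> ^ (r + 1) dvd x - 1" using x by (auto simp: mem_padic_sphere_iff)
  have "\<not> ?P dvd l" using coprime_common_divisor[OF l, of ?P] P by auto
  then have "[l ^ (?P - 1) = 1] (mod ?P ^ 1)" using fermat_theorem[OF P] by simp
  then have M1: "\<varpi> dvd M - 1"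
    using uniformizer_power_dvd_diff_of_nat[of 1 "l ^ (?P - 1)" 1, where 'p='p] by (simp add: M_def)
  have M2: "\<not> \<varpi> ^ 2 dvd M - 1"
    using generator_power_ne[OF P g] uniformizer_power_dvd_diff_of_nat[of 2 "l ^ (?P - 1)" 1, where 'p='p]
    by (simp add: M_def)
  \<comment> \<open>If \<open>l\<close> were 1 modulo p, so would be all its powers; but for odd p
    the unit 2 is one of them modulo p^2.\<close>
  have L1: "\<not> \<varpi> dvd (of_nat l - 1 :: 'p padic_int)"
  proof
    assume "\<varpi> dvd (of_nat l - 1 :: 'p padic_int)"
    then have l1: "[l = 1] (mod ?P)"
      using uniformizer_power_dvd_diff_of_nat[of 1 l 1, where 'p='p] by simp
    have "coprime 2 (?P ^ 2)" using p primes_coprime[OF two_is_prime_nat P] by simp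
    then obtain k where "[l ^ k = 2] (mod ?P ^ 2)" using gen by blast
    then have "[l ^ k = 2] (mod ?P)" by (rule cong_dvd_modulus_nat) simp
    moreover have "[l ^ k = 1] (mod ?P)" using cong_pow[OF l1, of k] by simp
    ultimately have "[2 = 1 + (0 :: nat)] (mod ?P)" by (metis add.right_neutral cong_sym cong_trans)
    then have "[1 = (0 :: nat)] (mod ?P)"
      by (metis add.right_neutral cong_add_lcancel_nat one_add_one)
    then show False using P by (simp add: cong_0_iff)
  qed
  obtain e where e: "\<varpi> ^ (r + 1) dvd e - 1"
    "\<And>j x. \<varpi> ^ r dvd x - 1 \<Longrightarrow> \<varpi> ^ (r + 2) dvd (f ^^ j) x - e - of_nat l ^ j * (x - e)"
    using near_affine_fixed_point[OF f f1 L1] by blast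
  \<comment> \<open>The multiplier of each of these iterates is a power of \<open>M\<close>, hence
    still 1 modulo p, as \<open>near_affine_funpow_prime_exact\<close> requires.\<close>
  have G: "near_affine r (M ^ (?P ^ k)) (f ^^ ((?P - 1) * ?P ^ k))" for k
    using near_affine_funpow[OF f, of "(?P - 1) * ?P ^ k"] by (simp add: M_def power_mult)
  have Gk: "\<varpi> dvd M ^ k - 1" for k using M1 by (simp add: power_diff_1_eq)
  show ?thesis
  proof (induction k)
    case 0
    \<comment> \<open>As \<open>e\<close> is closer to 1 than \<open>x\<close> is,
      \<open>x - e\<close> has valuation exactly \<open>r\<close>.\<close>
    have "\<not> \<varpi> ^ (r + 1) dvd x - e"
      using x'(2) dvd_add[OF _ e(1), of "x - e"] by auto
    moreover have "\<varpi> ^ r dvd e - 1" using e(1) by (rule power_le_dvd) simp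
    then have "\<varpi> ^ r dvd x - e" using dvd_diff[OF x'(1)] by force
    ultimately obtain a where a: "x - e = \<varpi> ^ r * a" "\<not> \<varpi> dvd a" by (auto elim!: dvdE)
    obtain b where b: "M - 1 = \<varpi> * b" "\<not> \<varpi> dvd b"
      using M1 M2 by (auto simp: power2_eq_square elim!: dvdE)
    define E where "E = (f ^^ (?P - 1)) x - x"
    have "\<varpi> ^ (r + 2) dvd E - (M - 1) * (x - e)"
      using e(2)[OF x'(1), of "?P - 1"] by (simp add: M_def E_def algebra_simps)
    moreover have "(M - 1) * (x - e) = \<varpi> ^ (r + 1) * (a * b)"
      unfolding a b by (simp add: algebra_simps)
    ultimately have E: "\<varpi> ^ (r + 2) dvd E - \<varpi> ^ (r + 1) * (a * b)" by simp
    then have "\<varpi> ^ (r + 1) dvd E - \<varpi> ^ (r + 1) * (a * b)" by (rule power_le_dvd) simp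
    then have "\<varpi> ^ (r + 1) dvd E" by (metis diff_add_cancel dvd_add dvd_triv_left)
    moreover have "\<not> \<varpi> ^ Suc (r + 1) dvd E"
    proof
      assume "\<varpi> ^ Suc (r + 1) dvd E"
      then have "\<varpi> ^ (r + 2) dvd E - (E - \<varpi> ^ (r + 1) * (a * b))" by (intro dvd_diff E) simp
      then have "\<varpi> ^ (r + 1) * \<varpi> dvd \<varpi> ^ (r + 1) * (a * b)" by (simp add: mult_ac)
      then have "\<varpi> dvd a * b" by (simp only: dvd_mult_cancel_left) simp
      then show False using a b uniformizer_dvd_mult_iff by blast
    qed
    ultimately show ?case by (simp add: E_def)
  next
    case (Suc k)
    have eq: "(f ^^ ((?P - 1) * ?P ^ Suc k)) = (f ^^ ((?P - 1) * ?P ^ k)) ^^ ?P"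
      by (simp add: funpow_mult mult_ac)
    show ?case
      unfolding eq add_Suc_right
      using near_affine_funpow_prime_exact[OF p G Gk x'(1) Suc.IH[THEN conjunct1] Suc.IH[THEN conjunct2]]
      by blast
  qed
qed

section \<open>Transitivity modulo powers of p and the generator property\<close>

text \<open>The target is approached digit by digit. A power of \<open>l\<close> matches the leading
  digits; afterwards an iterate that moves points by exactly \<open>\<varpi> ^ m\<close> is repeated
  until the next digit is right.\<close>

lemma generator_transitive:
  fixes f :: "'p::prime_card padic_int \<Rightarrow> 'p padic_int"
  assumes p: "CARD('p) \<noteq> 2" and f: "near_affine r (of_nat l) f" and f1: "\<varpi> ^ (r + 1) dvd f 1 - 1"
    and g: "generates_residue_units (CARD('p) ^ 2) l"
    and x: "x \<in> padic_sphere 1 r" and y: "y \<in> padic_sphere 1 r"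
  shows "\<exists>j. \<varpi> ^ n dvd (f ^^ j) x - y"
proof -
  let ?P = "CARD('p)"
  have P2: "1 < ?P ^ 2" by (intro one_less_power prime_gt_1_nat prime_card) simp
  have l: "coprime l (?P ^ 2)" and gen: "\<And>c. coprime c (?P ^ 2) \<Longrightarrow> \<exists>k. [l ^ k = c] (mod ?P ^ 2)"
    using g generates_residue_units_iff[OF P2] by auto
  have "\<exists>j. \<varpi> ^ (r + 1 + k) dvd (f ^^ j) x - y" for k
  proof (induction k)
    case 0
    obtain a where a: "x - 1 = \<varpi> ^ r * a" "\<not> \<varpi> dvd a" using padic_sphere_representation[OF x] .
    obtain b where b: "y - 1 = \<varpi> ^ r * b" "\<not> \<varpi> dvd b" using padic_sphere_representation[OF y] .
    \<comment> \<open>\<open>c\<close> is the quotient of the leading digits; a power of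
      \<open>l\<close> congruent to it sends one to the other.\<close>
    obtain c where c: "\<varpi> dvd of_nat c * a - b" using exists_of_nat_mult_cong[OF a(2)] .
    have "\<not> \<varpi> dvd (of_nat c :: 'p padic_int)"
    proof
      assume "\<varpi> dvd (of_nat c :: 'p padic_int)"
      then have "\<varpi> dvd of_nat c * a - (of_nat c * a - b)" by (rule dvd_diff[OF dvd_mult2 c])
      then show False using b(2) by simp
    qed
    then obtain j where "[l ^ j = c] (mod ?P ^ 2)" using gen coprime_uniformizer_iff by blast
    then have "[l ^ j = c] (mod ?P ^ 1)" by (rule cong_dvd_modulus_nat) simp
    then have "\<varpi> dvd (of_nat (l ^ j) - of_nat c :: 'p padic_int)"
      using uniformizer_power_dvd_diff_of_nat[of 1 "l ^ j" c, where 'p='p] by simp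
    then have "\<varpi> dvd (of_nat (l ^ j) - of_nat c) * a + (of_nat c * a - b)"
      using c by (intro dvd_add dvd_mult2)
    then have "\<varpi> dvd of_nat l ^ j * a - b" by (simp add: algebra_simps)
    then have "\<varpi> ^ r * \<varpi> dvd \<varpi> ^ r * (of_nat l ^ j * a - b)" by (intro mult_dvd_mono) auto
    moreover have "\<varpi> ^ r * (of_nat l ^ j * a - b) = of_nat l ^ j * (x - 1) - (y - 1)"
      unfolding a b by (simp add: algebra_simps)
    ultimately have "\<varpi> ^ (r + 1) dvd of_nat l ^ j * (x - 1) - (y - 1)"
      by (simp only: power_add power_one_right)
    moreover have "\<varpi> ^ (r + 1) dvd (f ^^ j) x - 1 - of_nat l ^ j * (x - 1)"
      by (rule near_affine_linear[OF f f1]) (simp add: a)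
    ultimately have "\<varpi> ^ (r + 1) dvd
        ((f ^^ j) x - 1 - of_nat l ^ j * (x - 1)) + (of_nat l ^ j * (x - 1) - (y - 1))"
      by (intro dvd_add)
    then have "\<varpi> ^ (r + 1 + 0) dvd (f ^^ j) x - y" by simp
    then show ?case by blast
  next
    case (Suc k)
    define m where "m = r + 1 + k"
    define N where "N = (?P - 1) * ?P ^ k"
    obtain j where j: "\<varpi> ^ m dvd (f ^^ j) x - y" using Suc.IH by (auto simp: m_def)
    define z where "z = (f ^^ j) x"
    have "\<not> \<varpi> dvd (of_nat l :: 'p padic_int)" using l by (simp only: coprime_uniformizer_iff not_False_eq_True)
    then have "(f ^^ j) x \<in> padic_sphere 1 r"
      by (induction j) (simp_all add: x near_affine_sphere[OF f f1])
    then have z: "z \<in> padic_sphere 1 r" by (simp add: z_def)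
    then have z1: "\<varpi> ^ r dvd z - 1" by (simp add: mem_padic_sphere_iff)
    have dz: "\<varpi> ^ m dvd (f ^^ N) z - z" "\<not> \<varpi> ^ Suc m dvd (f ^^ N) z - z"
      using near_affine_generator_displacement[OF p f f1 g z, of k] by (auto simp: m_def N_def)
    then obtain d where d: "(f ^^ N) z - z = \<varpi> ^ m * d" "\<not> \<varpi> dvd d" by (auto elim!: dvdE)
    obtain w where w: "z - y = \<varpi> ^ m * w" using j by (auto simp: z_def)
    \<comment> \<open>Repeating the \<open>N\<close>-th iterate \<open>i\<close> times moves
      \<open>z\<close> by about \<open>i\<close> times \<open>\<varpi> ^ m * d\<close>, which
      cancels the remaining error \<open>\<varpi> ^ m * w\<close> to one more digit.\<close>
    obtain i where i: "\<varpi> dvd of_nat i * d - (- w)" using exists_of_nat_mult_cong[OF d(2)] .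
    have "\<not> ?P dvd l" using coprime_common_divisor[OF l, of ?P] prime_card[where 'a='p] by auto
    then have "[l ^ (?P - 1) = 1] (mod ?P)" using fermat_theorem[OF prime_card] by blast
    then have "[l ^ N = 1] (mod ?P ^ 1)"
      using cong_pow[of "l ^ (?P - 1)" 1 ?P "?P ^ k"] by (simp add: N_def power_mult)
    then have "\<varpi> dvd (of_nat l ^ N - 1 :: 'p padic_int)"
      using uniformizer_power_dvd_diff_of_nat[of 1 "l ^ N" 1, where 'p='p] by simp
    then have 1: "\<varpi> ^ (m + 1) dvd ((f ^^ N) ^^ i) z - z - of_nat i * ((f ^^ N) z - z)"
      using near_affine_drift[OF near_affine_funpow[OF f] _ z1 dz(1)] by blast
    have "\<varpi> ^ m * \<varpi> dvd \<varpi> ^ m * (of_nat i * d - (- w))" using i by (intro mult_dvd_mono) auto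
    moreover have "\<varpi> ^ m * (of_nat i * d - (- w)) = of_nat i * ((f ^^ N) z - z) + (z - y)"
      unfolding d w by (simp add: algebra_simps)
    ultimately have 2: "\<varpi> ^ (m + 1) dvd of_nat i * ((f ^^ N) z - z) + (z - y)"
      by (simp only: power_add power_one_right)
    have "\<varpi> ^ (m + 1) dvd ((f ^^ N) ^^ i) z - y" using dvd_add[OF 1 2] by simp
    moreover have "((f ^^ N) ^^ i) z = (f ^^ (N * i + j)) x"
      by (simp add: z_def funpow_mult funpow_add)
    ultimately have "\<varpi> ^ (r + 1 + Suc k) dvd (f ^^ (N * i + j)) x - y" by (simp add: m_def)
    then show ?case by blast
  qed
  \<comment> \<open>The induction starts at exponent \<open>r + 1\<close>; going beyond
    \<open>n\<close> covers small \<open>n\<close> as well.\<close>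
  then obtain j where "\<varpi> ^ (r + 1 + n) dvd (f ^^ j) x - y" by blast
  then have "\<varpi> ^ n dvd (f ^^ j) x - y" by (rule power_le_dvd) simp
  then show ?thesis by blast
qed

text \<open>Once \<open>l\<close> and \<open>l - 1\<close> are known to be units, the linear formula
  about the approximate fixed point \<open>e\<close> turns a meeting of two orbits into a congruence
  modulo p^2 between multiples of powers of \<open>l\<close>.\<close>

lemma generates_if_orbits_meet:
  fixes f :: "'p::prime_card padic_int \<Rightarrow> 'p padic_int"
  assumes p: "CARD('p) \<noteq> 2" and f: "near_affine r (of_nat l) f" and f1: "\<varpi> ^ (r + 1) dvd f 1 - 1"
    and S: "f ` padic_sphere 1 r \<subseteq> padic_sphere 1 r"
    and meet: "\<And>x y. x \<in> padic_sphere 1 r \<Longrightarrow> y \<in> padic_sphere 1 r \<Longrightarrow>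
      \<exists>i j. \<varpi> ^ (r + 2) dvd (f ^^ i) x - (f ^^ j) y"
  shows "generates_residue_units (CARD('p) ^ 2) l"
proof -
  let ?P = "CARD('p)" and ?L = "of_nat l :: 'p padic_int"
  have P: "prime ?P" by (rule prime_card)
  \<comment> \<open>The centre may be moved from 1 to \<open>e\<close> because the shift is smaller
    than the radius.\<close>
  have sph: "e + \<varpi> ^ r * a \<in> padic_sphere 1 r"
    if "\<varpi> ^ (r + 1) dvd e - 1" "\<not> \<varpi> dvd a" for e a :: "'p padic_int"
  proof -
    have "\<varpi> ^ r dvd e - 1" using that(1) by (rule power_le_dvd) simp
    then have "\<varpi> ^ r dvd (e - 1) + \<varpi> ^ r * a" by simp
    moreover have "\<not> \<varpi> ^ (r + 1) dvd (e - 1) + \<varpi> ^ r * a"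
    proof
      assume "\<varpi> ^ (r + 1) dvd (e - 1) + \<varpi> ^ r * a"
      then have "\<varpi> ^ r * \<varpi> dvd \<varpi> ^ r * a"
        using that(1) by (simp add: dvd_add_right_iff mult.commute)
      then show False using that(2) by (simp only: dvd_mult_cancel_left) simp
    qed
    ultimately show ?thesis by (simp add: mem_padic_sphere_iff algebra_simps)
  qed
  have unit_1: "\<not> \<varpi> dvd (1 :: 'p padic_int)" using unit_iff_not_uniformizer_dvd[of "1 :: 'p padic_int"] by simp
  have "coprime 2 (?P ^ 2)" using p primes_coprime[OF two_is_prime_nat P] by simp
  then have unit_2: "\<not> \<varpi> dvd (2 :: 'p padic_int)"
    using coprime_uniformizer_iff[of 2, where 'p='p] by simp
  \<comment> \<open>If p divided \<open>l\<close>, then \<open>f\<close> would send a point of the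
    sphere into the smaller ball about 1.\<close>
  have L: "\<not> \<varpi> dvd ?L"
  proof
    assume L: "\<varpi> dvd ?L"
    have "1 + \<varpi> ^ r * 1 \<in> (padic_sphere 1 r :: 'p padic_int set)" using sph[of 1 1] unit_1 by simp
    then have "f (1 + \<varpi> ^ r * 1) \<in> padic_sphere 1 r" using S by blast
    moreover have "\<varpi> ^ (r + 1) dvd (f ^^ 1) (1 + \<varpi> ^ r * 1) - 1 - ?L ^ 1 * (1 + \<varpi> ^ r * 1 - 1)"
      by (rule near_affine_linear[OF f f1]) simp
    then have "\<varpi> ^ (r + 1) dvd
        ((f ^^ 1) (1 + \<varpi> ^ r * 1) - 1 - ?L ^ 1 * (1 + \<varpi> ^ r * 1 - 1)) + ?L * \<varpi> ^ r"
      using L by (intro dvd_add) (simp_all add: mult_dvd_mono)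
    ultimately show False by (simp add: mem_padic_sphere_iff)
  qed
  \<comment> \<open>If \<open>l\<close> were 1 modulo p, the leading digit of \<open>x - 1\<close>
    would be constant along orbits, so those of the points with digits 1 and 2 could not meet. For
    odd p both points lie on the sphere.\<close>
  have L1: "\<not> \<varpi> dvd ?L - 1"
  proof
    assume L1: "\<varpi> dvd ?L - 1"
    obtain i j where "\<varpi> ^ (r + 2) dvd (f ^^ i) (1 + \<varpi> ^ r * 1) - (f ^^ j) (1 + \<varpi> ^ r * 2)"
      using meet[OF sph[of 1 1] sph[of 1 2]] unit_1 unit_2 by auto
    then have 1: "\<varpi> ^ (r + 1) dvd (f ^^ i) (1 + \<varpi> ^ r * 1) - (f ^^ j) (1 + \<varpi> ^ r * 2)"
      by (rule power_le_dvd) simp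
    have lin: "\<varpi> ^ (r + 1) dvd (f ^^ k) (1 + \<varpi> ^ r * a) - 1 - \<varpi> ^ r * a" for k a
    proof -
      have "\<varpi> dvd ?L ^ k - 1" using L1 by (simp add: power_diff_1_eq)
      then have "\<varpi> ^ r * \<varpi> dvd (\<varpi> ^ r * a) * (?L ^ k - 1)" by (intro mult_dvd_mono) auto
      moreover have "\<varpi> ^ (r + 1) dvd (f ^^ k) (1 + \<varpi> ^ r * a) - 1 - ?L ^ k * (1 + \<varpi> ^ r * a - 1)"
        by (rule near_affine_linear[OF f f1]) simp
      ultimately have "\<varpi> ^ (r + 1) dvd
          ((f ^^ k) (1 + \<varpi> ^ r * a) - 1 - ?L ^ k * (1 + \<varpi> ^ r * a - 1)) + (\<varpi> ^ r * a) * (?L ^ k - 1)"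
        by (intro dvd_add) (simp_all add: mult.commute)
      then show ?thesis by (simp add: algebra_simps)
    qed
    have "\<varpi> ^ (r + 1) dvd (f ^^ i) (1 + \<varpi> ^ r * 1) - (f ^^ j) (1 + \<varpi> ^ r * 2)
        - ((f ^^ i) (1 + \<varpi> ^ r * 1) - 1 - \<varpi> ^ r * 1) + ((f ^^ j) (1 + \<varpi> ^ r * 2) - 1 - \<varpi> ^ r * 2)"
      by (intro dvd_add dvd_diff 1 lin)
    then have "\<varpi> ^ r * \<varpi> dvd (\<varpi> ^ r * 1 :: 'p padic_int)" by (simp add: algebra_simps)
    then have "\<varpi> dvd (1 :: 'p padic_int)" unfolding dvd_mult_cancel_left by simp
    with unit_1 show False by blast
  qed
  obtain e where e: "\<varpi> ^ (r + 1) dvd e - 1"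
    "\<And>j x. \<varpi> ^ r dvd x - 1 \<Longrightarrow> \<varpi> ^ (r + 2) dvd (f ^^ j) x - e - ?L ^ j * (x - e)"
    using near_affine_fixed_point[OF f f1 L1] by blast
  show ?thesis
  proof (rule generates_residue_unitsI)
    show "1 < ?P ^ 2" using P by (intro one_less_power prime_gt_1_nat) simp_all
    show "coprime l (?P ^ 2)" using L coprime_uniformizer_iff by blast
    fix c assume "coprime c (?P ^ 2)"
    then have c: "\<not> \<varpi> dvd (of_nat c :: 'p padic_int)"
      unfolding coprime_uniformizer_iff .
    \<comment> \<open>The differences to \<open>e\<close> are \<open>\<varpi> ^ r\<close> times
      \<open>c\<close> and times 1; cancelling \<open>\<varpi> ^ r\<close> from the modulus leaves
      p^2.\<close>
    define x where "x = e + \<varpi> ^ r * of_nat c"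
    define y where "y = e + \<varpi> ^ r * 1"
    have xy: "x \<in> padic_sphere 1 r" "y \<in> padic_sphere 1 r"
      unfolding x_def y_def using sph e(1) c unit_1 by blast+
    then have xy': "\<varpi> ^ r dvd x - 1" "\<varpi> ^ r dvd y - 1" by (simp_all add: mem_padic_sphere_iff)
    obtain i j where ij: "\<varpi> ^ (r + 2) dvd (f ^^ i) x - (f ^^ j) y" using meet[OF xy] by blast
    have "\<varpi> ^ (r + 2) dvd ((f ^^ i) x - (f ^^ j) y) - ((f ^^ i) x - e - ?L ^ i * (x - e))
        + ((f ^^ j) y - e - ?L ^ j * (y - e))"
      by (intro dvd_add dvd_diff ij e(2) xy')
    then have "\<varpi> ^ (r + 2) dvd ?L ^ i * (x - e) - ?L ^ j * (y - e)" by (simp add: algebra_simps)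
    moreover have "?L ^ i * (x - e) - ?L ^ j * (y - e) = \<varpi> ^ r * (of_nat (l ^ i * c) - of_nat (l ^ j))"
      by (simp add: x_def y_def algebra_simps)
    ultimately have "\<varpi> ^ r * \<varpi> ^ 2 dvd \<varpi> ^ r * (of_nat (l ^ i * c) - of_nat (l ^ j) :: 'p padic_int)"
      by (simp only: power_add)
    then have "\<varpi> ^ 2 dvd (of_nat (l ^ i * c) - of_nat (l ^ j) :: 'p padic_int)"
      by (simp only: dvd_mult_cancel_left) simp
    then have "[l ^ i * c = l ^ j] (mod ?P ^ 2)" unfolding uniformizer_power_dvd_diff_of_nat .
    then show "\<exists>i j. [l ^ i * c = l ^ j] (mod ?P ^ 2)" by blast
  qed
qed


section \<open>The measure on the sphere\<close>

text \<open>Membership in the sphere depends only on the residue modulo p^(r + 1), which the residue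
  modulo p^n determines.\<close>

lemma residue_ball_subset_sphere:
  fixes x :: "'p::prime_card padic_int"
  assumes x: "x \<in> padic_sphere y r" and n: "r < n"
  shows "residue_ball n (residue x n) \<subseteq> padic_sphere y r"
proof
  fix z :: "'p padic_int"
  assume "z \<in> residue_ball n (residue x n)"
  then have "residue z n = residue x n" by (simp add: residue_ball_def)
  then have "residue z m = residue x m" if "m \<le> n" for m
    using residue_mod_le[OF that, of z] residue_mod_le[OF that, of x] by simp
  then have "residue z r = residue x r" "residue z (Suc r) = residue x (Suc r)" using n by simp_all
  then show "z \<in> padic_sphere y r"
    using x unfolding mem_padic_sphere_iff p_pow_dvd_iff residue_diff_eq_0_iff by simp
qed

lemma borel_padic_sphere [measurable]: "padic_sphere (y :: 'p::prime_card padic_int) r \<in> sets borel"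
proof -
  have "padic_sphere y r = residue_ball r (residue y r) - residue_ball (Suc r) (residue y (Suc r))"
    by (auto simp: mem_padic_sphere_iff p_pow_dvd_iff residue_diff_eq_0_iff residue_ball_def
        simp del: power_Suc)
  then show ?thesis by (simp add: borel_open open_residue_ball sets.Diff)
qed

lemma sets_haar_measure: "sets (haar_measure :: 'p::prime_card padic_int measure) = sets borel"
  using is_haar_measure_haar_measure unfolding is_haar_measure_def by blast

lemma emeasure_haar_ball:
  "emeasure haar_measure (residue_ball n (residue (x :: 'p::prime_card padic_int) n) :: 'p padic_int set)
    = 1 / of_nat (CARD('p) ^ n)"
  using residue_range[of x n] by (intro haar_residue_ball is_haar_measure_haar_measure) simp

text \<open>These bounds make the normalizing factor of \<open>sphere_measure\<close> finite and
  positive: the sphere contains a ball and lies in a space of measure 1.\<close>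

lemma emeasure_haar_sphere:
  fixes y :: "'p::prime_card padic_int"
  shows "emeasure haar_measure (padic_sphere y r) \<noteq> 0"
    and "emeasure haar_measure (padic_sphere y r) \<noteq> \<infinity>"
proof -
  let ?\<mu> = "haar_measure :: 'p padic_int measure"
  have "y + \<varpi> ^ r \<in> padic_sphere y r"
    using unit_iff_not_uniformizer_dvd[of "1 :: 'p padic_int"] dvd_mult_cancel_left[of "\<varpi> ^ r" \<varpi> 1]
    by (simp add: mem_padic_sphere_iff mult.commute)
  then have "residue_ball (Suc r) (residue (y + \<varpi> ^ r) (Suc r)) \<subseteq> padic_sphere y r"
    by (rule residue_ball_subset_sphere) simp
  then have "emeasure ?\<mu> (residue_ball (Suc r) (residue (y + \<varpi> ^ r) (Suc r)))
      \<le> emeasure ?\<mu> (padic_sphere y r)"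
    by (rule emeasure_mono) (simp add: sets_haar_measure borel_padic_sphere)
  moreover have "1 / of_nat (CARD('p) ^ Suc r) \<noteq> (0 :: ennreal)"
    by (simp add: ennreal_divide_eq_0_iff del: of_nat_power power_Suc)
  ultimately show "emeasure ?\<mu> (padic_sphere y r) \<noteq> 0"
    unfolding emeasure_haar_ball by (metis le_zero_eq)
  have "emeasure ?\<mu> (padic_sphere y r) \<le> emeasure ?\<mu> UNIV"
    by (rule emeasure_mono) (simp_all add: sets_haar_measure)
  also have "\<dots> = 1" using is_haar_measure_haar_measure unfolding is_haar_measure_def by blast
  finally show "emeasure ?\<mu> (padic_sphere y r) \<noteq> \<infinity>"
    by (auto simp: top_unique)
qed

lemma space_sphere_measure [simp]:
  "space (sphere_measure y r) = padic_sphere (y :: 'p::prime_card padic_int) r"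
  using sets_eq_imp_space_eq[OF sets_haar_measure[where 'p='p]]
  by (simp add: sphere_measure_def space_scale_measure space_restrict_space)

lemma sets_sphere_measure: "sets (sphere_measure y r) = sets (restrict_space borel (padic_sphere y r))"
  by (simp add: sphere_measure_def sets_restrict_space_cong[OF sets_haar_measure])

lemma mem_sets_sphere_measure_iff:
  "A \<in> sets (sphere_measure y r) \<longleftrightarrow> A \<in> sets borel \<and> A \<subseteq> padic_sphere y r"
  unfolding sets_sphere_measure by (subst sets_restrict_space_iff) auto

lemma emeasure_sphere_measure:
  assumes "A \<in> sets borel" "A \<subseteq> padic_sphere y r"
  shows "emeasure (sphere_measure y r) A
    = emeasure haar_measure A / emeasure haar_measure (padic_sphere y r)"
  using assms unfolding sphere_measure_def emeasure_scale_measure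
  by (subst emeasure_restrict_space)
    (simp_all add: sets_haar_measure borel_padic_sphere divide_ennreal_def mult.commute)

lemma emeasure_sphere_measure_sphere: "emeasure (sphere_measure y r) (padic_sphere y r) = 1"
  using emeasure_haar_sphere[of y r]
  by (simp add: emeasure_sphere_measure borel_padic_sphere ennreal_divide_self top.not_eq_extremum)

lemma emeasure_sphere_measure_ball:
  fixes x :: "'p::prime_card padic_int"
  assumes "x \<in> padic_sphere y r" "r < n"
  shows "emeasure (sphere_measure y r) (residue_ball n (residue x n))
    = 1 / of_nat (CARD('p) ^ n) / emeasure haar_measure (padic_sphere y r)"
  using residue_ball_subset_sphere[OF assms]
  by (simp only: emeasure_sphere_measure borel_open open_residue_ball emeasure_haar_ball)

lemma emeasure_sphere_measure_ball_pos:
  fixes x :: "'p::prime_card padic_int"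
  assumes "x \<in> padic_sphere y r" "r < n"
  shows "0 < emeasure (sphere_measure y r) (residue_ball n (residue x n))"
  unfolding emeasure_sphere_measure_ball[OF assms]
  using emeasure_haar_sphere(2)[of y r]
  by (simp add: zero_less_iff_neq_zero ennreal_divide_eq_0_iff ennreal_divide_eq_top_iff
      del: of_nat_power)

lemma emeasure_eq_of_null_complement:
  assumes "S \<in> sets M" "A \<in> sets M" "emeasure M (space M - S) = 0"
  shows "S \<subseteq> A \<Longrightarrow> emeasure M A = emeasure M (space M)"
    and "A \<inter> S = {} \<Longrightarrow> emeasure M A = 0"
proof -
  assume "S \<subseteq> A"
  have "emeasure M (space M) \<le> emeasure M (A \<union> (space M - S))"
    using \<open>S \<subseteq> A\<close> assms by (intro emeasure_mono) auto
  also have "\<dots> \<le> emeasure M A + emeasure M (space M - S)"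
    using assms by (intro emeasure_subadditive) auto
  finally show "emeasure M A = emeasure M (space M)"
    using assms emeasure_space[of M A] by (simp add: antisym)
next
  assume "A \<inter> S = {}"
  then have "emeasure M A \<le> emeasure M (space M - S)"
    using assms sets.sets_into_space[OF assms(2)] by (intro emeasure_mono) auto
  then show "emeasure M A = 0" using assms by simp
qed

text \<open>Finitely many disjoint balls of a given small radius cover the sphere, so if they have
  equal mass, that mass is the total divided by their number. This uniqueness yields both invariance
  and ergodicity below.\<close>

lemma measure_eqI_sphere:
  fixes M N :: "'p::prime_card padic_int measure"
  assumes sets: "sets M = sets borel" "sets N = sets borel"
    and null: "emeasure M (- padic_sphere y r) = 0" "emeasure N (- padic_sphere y r) = 0"
    and total: "emeasure M UNIV = emeasure N UNIV" "emeasure M UNIV \<noteq> \<infinity>"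
    and M: "\<And>x z n. x \<in> padic_sphere y r \<Longrightarrow> z \<in> padic_sphere y r \<Longrightarrow> r < n \<Longrightarrow>
      emeasure M (residue_ball n (residue x n)) = emeasure M (residue_ball n (residue z n))"
    and N: "\<And>x z n. x \<in> padic_sphere y r \<Longrightarrow> z \<in> padic_sphere y r \<Longrightarrow> r < n \<Longrightarrow>
      emeasure N (residue_ball n (residue x n)) = emeasure N (residue_ball n (residue z n))"
  shows "M = N"
proof (rule measure_eqI_residue_balls[OF sets total(2)])
  fix n k
  let ?S = "padic_sphere y r" and ?B = "residue_ball n k :: 'p padic_int set"
  have borel: "residue_ball n k \<in> sets (borel :: 'p padic_int measure)" for n k
    by (intro borel_open open_residue_ball)
  have space: "space M = UNIV" "space N = UNIV"
    using sets_eq_imp_space_eq[OF sets(1)] sets_eq_imp_space_eq[OF sets(2)] by simp_all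
  have full: "emeasure Q A = emeasure Q UNIV" if "Q \<in> {M, N}" "A \<in> sets borel" "?S \<subseteq> A" for Q A
    using that emeasure_eq_of_null_complement(1)[of ?S Q A] null sets space borel_padic_sphere
    by (auto simp: Compl_eq_Diff_UNIV)
  have empty: "emeasure Q A = 0" if "Q \<in> {M, N}" "A \<in> sets borel" "A \<inter> ?S = {}" for Q A
    using that emeasure_eq_of_null_complement(2)[of ?S Q A] null sets space borel_padic_sphere
    by (auto simp: Compl_eq_Diff_UNIV)
  \<comment> \<open>The basis of balls also has members that miss the sphere or contain all of it;
    their masses are zero and total.\<close>
  consider "?B \<inter> ?S = {}" | "?S \<subseteq> ?B" | x where "x \<in> ?S" "residue x n = k" "r < n"
  proof (cases "n \<le> r")
    case True
    have eq: "residue x n = residue y n" if "x \<in> ?S" for x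
      using that residue_mod_le[OF True, of x] residue_mod_le[OF True, of y]
      unfolding mem_padic_sphere_iff p_pow_dvd_iff residue_diff_eq_0_iff by simp
    show ?thesis
    proof (cases "residue y n = k")
      case True
      then show ?thesis using eq by (intro that(2)) (auto simp: residue_ball_def)
    next
      case False
      then show ?thesis using eq by (intro that(1)) (auto simp: residue_ball_def)
    qed
  next
    case False
    then show ?thesis using that(1,3) by (auto simp: residue_ball_def)
  qed
  then show "emeasure M ?B = emeasure N ?B"
  proof cases
    case 1
    then show ?thesis using empty[of M ?B] empty[of N ?B] borel by simp
  next
    case 2
    then show ?thesis using full[of M ?B] full[of N ?B] borel total(1) by simp
  next
    case (3 x)
    \<comment> \<open>\<open>R\<close> indexes the balls that make up the sphere, so its cardinality
      is the same divisor for both measures.\<close>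
    define R where "R = (\<lambda>x. residue x n) ` ?S"
    have "R \<subseteq> {0..<int CARD('p) ^ n}"
      unfolding R_def
      by (intro image_subsetI) (simp only: atLeastLessThan_iff residue_range simp_thms)
    then have R: "finite R" by (rule finite_subset) simp
    have "R \<noteq> {}" using 3(1) by (auto simp: R_def)
    then have card: "of_nat (card R) \<noteq> (0 :: ennreal)" "of_nat (card R) \<noteq> (\<top> :: ennreal)"
      using R by auto
    have cover: "?S \<subseteq> (\<Union>i\<in>R. residue_ball n i)" by (auto simp: R_def residue_ball_def)
    have sum: "of_nat (card R) * emeasure Q ?B = emeasure Q UNIV"
      if Q: "Q \<in> {M, N}"
        and eq: "\<And>z. z \<in> ?S \<Longrightarrow> emeasure Q (residue_ball n (residue z n)) = emeasure Q ?B" for Q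
    proof -
      have "emeasure Q UNIV = emeasure Q (\<Union>i\<in>R. residue_ball n i)"
        using full[OF Q _ cover] R borel by auto
      also have "\<dots> = (\<Sum>i\<in>R. emeasure Q (residue_ball n i))"
        using R Q sets borel
        by (intro sum_emeasure[symmetric]) (auto simp: disjoint_family_on_def residue_ball_def)
      also have "\<dots> = (\<Sum>i\<in>R. emeasure Q ?B)"
        using eq by (intro sum.cong) (auto simp: R_def)
      finally show ?thesis by simp
    qed
    have "emeasure M (residue_ball n (residue z n)) = emeasure M ?B" if "z \<in> ?S" for z
      using M[OF that 3(1,3)] 3(2) by simp
    then have "of_nat (card R) * emeasure M ?B = emeasure M UNIV" by (intro sum) simp_all
    moreover have "emeasure N (residue_ball n (residue z n)) = emeasure N ?B" if "z \<in> ?S" for z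
      using N[OF that 3(1,3)] 3(2) by simp
    then have "of_nat (card R) * emeasure N ?B = emeasure N UNIV" by (intro sum) simp_all
    ultimately have "of_nat (card R) * emeasure M ?B = of_nat (card R) * emeasure N ?B"
      using total(1) by simp
    then show ?thesis using card by (simp add: ennreal_mult_cancel_left)
  qed
qed

section \<open>Transitivity and ergodicity\<close>

text \<open>By the isometry, preimages of balls in the sphere are empty or balls of the same radius,
  and by transitivity one orbit visits all balls of that radius. So the image measure, and the
  measure restricted to an invariant set, give these balls equal mass, and
  \<open>measure_eqI_sphere\<close> identifies both.\<close>

lemma isometric_transitive_imp_ergodic_on_sphere:
  fixes f :: "'p::prime_card padic_int \<Rightarrow> 'p padic_int"
  assumes S: "f ` padic_sphere y r \<subseteq> padic_sphere y r"
    and iso: "\<And>x z n. x \<in> padic_sphere y r \<Longrightarrow> z \<in> padic_sphere y r \<Longrightarrow>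
      residue (f x) n = residue (f z) n \<longleftrightarrow> residue x n = residue z n"
    and trans: "\<And>x z n. x \<in> padic_sphere y r \<Longrightarrow> z \<in> padic_sphere y r \<Longrightarrow>
      \<exists>j. residue ((f ^^ j) x) n = residue z n"
  shows "ergodic_on_sphere f y r"
proof -
  let ?S = "padic_sphere y r" and ?M = "sphere_measure y r"
  define B :: "'p padic_int \<Rightarrow> nat \<Rightarrow> 'p padic_int set"
    where "B x n = residue_ball n (residue x n)" for x n
  have B_borel: "B x n \<in> sets borel" for x n unfolding B_def by (intro borel_open open_residue_ball)
  have B_sub: "B x n \<subseteq> ?S" if "x \<in> ?S" "r < n" for x n
    unfolding B_def using that by (rule residue_ball_subset_sphere)
  have B_sets: "B x n \<in> sets ?M" if "x \<in> ?S" "r < n" for x n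
    using B_borel B_sub[OF that] by (simp add: mem_sets_sphere_measure_iff)
  have fj: "(f ^^ j) x \<in> ?S" if "x \<in> ?S" for j x
    using that S by (induction j) auto
  have pre_ball: "f -` B (f x) n \<inter> ?S = B x n \<inter> ?S" if "x \<in> ?S" for x n
    using iso[OF _ that] by (auto simp: B_def residue_ball_def)
  have fb: "f \<in> measurable ?M borel"
  proof (rule measurable_sigma_sets[OF sets_borel_padic])
    fix C :: "'p padic_int set"
    assume "C \<in> residue_balls"
    then obtain n k where C: "C = residue_ball n k" by (auto simp: residue_balls_def)
    show "f -` C \<inter> space ?M \<in> sets ?M"
    proof (cases "\<exists>x\<in>?S. f x \<in> C")
      case True
      then obtain x where x: "x \<in> ?S" "C = B (f x) n" by (auto simp: C B_def residue_ball_def)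
      then show ?thesis
        using pre_ball[OF x(1)] B_borel[of x n] borel_padic_sphere[of y r]
        by (simp add: mem_sets_sphere_measure_iff sets.Int)
    next
      case False
      then have "f -` C \<inter> space ?M = {}" by auto
      then show ?thesis by simp
    qed
  qed auto
  then have f: "f \<in> measurable ?M ?M"
    using S unfolding measurable_cong_sets[OF refl sets_sphere_measure]
    by (intro measurable_restrict_space2) auto
  have id: "(\<lambda>x. x) \<in> measurable ?M borel"
    using sets.Int[OF _ borel_padic_sphere]
    by (auto simp: measurable_def mem_sets_sphere_measure_iff)
  \<comment> \<open>This extends the sphere measure by zero to a Borel measure on the whole ring,
    where \<open>measure_eqI_sphere\<close> applies.\<close>
  define N where "N = distr ?M borel (\<lambda>x. x)"
  have N: "emeasure N A = emeasure ?M (A \<inter> ?S)" if "A \<in> sets borel" for A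
    unfolding N_def using that id by (simp add: emeasure_distr)
  have N_B: "emeasure N (B x n) = emeasure N (B z n)" if "x \<in> ?S" "z \<in> ?S" "r < n" for x z n
  proof -
    have "B x n \<inter> ?S = B x n" "B z n \<inter> ?S = B z n" using B_sub that by blast+
    then show ?thesis
      using that emeasure_sphere_measure_ball[of x y r n] emeasure_sphere_measure_ball[of z y r n]
      by (simp add: N B_borel B_def[symmetric])
  qed
  have pres: "emeasure ?M (f -` A \<inter> ?S) = emeasure ?M A" if A: "A \<in> sets ?M" for A
  proof -
    have F: "emeasure (distr ?M borel f) A = emeasure ?M (f -` A \<inter> ?S)" if "A \<in> sets borel" for A
      using that fb by (simp add: emeasure_distr)
    have FB: "emeasure (distr ?M borel f) (B x n) = emeasure ?M (B z n)"
      if xz: "x \<in> ?S" "z \<in> ?S" and n: "r < n" for x z n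
    proof -
      \<comment> \<open>The orbit of \<open>f x\<close> returns to the ball of \<open>x\<close>; the
        point one step before the return shows that this ball has a nonempty preimage.\<close>
      obtain j where j: "residue ((f ^^ j) (f x)) n = residue x n"
        using trans[of "f x" x n] S xz by blast
      let ?w = "(f ^^ j) x"
      have w: "?w \<in> ?S" by (rule fj[OF xz(1)])
      have "B x n = B (f ?w) n" using j by (simp add: B_def funpow_swap1)
      then have "f -` B x n \<inter> ?S = B ?w n" using pre_ball[OF w] B_sub[OF w n] by blast
      then have "emeasure (distr ?M borel f) (B x n) = emeasure ?M (B ?w n)"
        by (simp only: F[OF B_borel])
      then show ?thesis
        by (simp only: B_def emeasure_sphere_measure_ball[OF w n]
            emeasure_sphere_measure_ball[OF xz(2) n])
    qed
    have "distr ?M borel f = N"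
    proof (rule measure_eqI_sphere)
      show "emeasure (distr ?M borel f) (- ?S) = 0"
      proof -
        have "f -` (- ?S) \<inter> ?S = {}" using S by blast
        then show ?thesis using borel_padic_sphere[of y r] by (subst F) simp_all
      qed
      show "emeasure N (- ?S) = 0" using borel_padic_sphere[of y r] by (subst N) auto
      show "emeasure (distr ?M borel f) UNIV = emeasure N UNIV" by (simp add: F N)
      show "emeasure (distr ?M borel f) UNIV \<noteq> \<infinity>" by (simp add: F emeasure_sphere_measure_sphere)
      show "emeasure (distr ?M borel f) (residue_ball n (residue x n))
          = emeasure (distr ?M borel f) (residue_ball n (residue z n))"
        if "x \<in> ?S" "z \<in> ?S" "r < n" for x z n
        using FB[OF that(1,2,3)] FB[OF that(2,2,3)] by (simp only: B_def)
      show "sets (distr ?M borel f) = sets borel" "sets N = sets borel" by (simp_all add: N_def)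
    qed (fact N_B[unfolded B_def])
    then show ?thesis
      using A F[of A] N[of A] by (auto simp: mem_sets_sphere_measure_iff Int_absorb2)
  qed
  have "emeasure ?M A = 0 \<or> emeasure ?M A = 1" if A: "A \<in> sets ?M" and inv: "f -` A \<inter> ?S = A" for A
  proof -
    have A': "A \<in> sets borel" "A \<subseteq> ?S" using A by (simp_all add: mem_sets_sphere_measure_iff)
    define Q where "Q = distr (density ?M (indicator A)) borel (\<lambda>x. x)"
    have Q: "emeasure Q X = emeasure ?M (A \<inter> X)" if X: "X \<in> sets borel" for X
    proof -
      have "X \<inter> ?S \<in> sets ?M"
        using X borel_padic_sphere[of y r] by (simp add: mem_sets_sphere_measure_iff sets.Int)
      moreover have "A \<inter> (X \<inter> ?S) = A \<inter> X" using A'(2) by blast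
      ultimately have "A \<inter> X \<in> sets ?M" using sets.Int[OF A] by metis
      with \<open>A \<inter> (X \<inter> ?S) = A \<inter> X\<close> show ?thesis
        unfolding Q_def using X id A
        by (simp add: emeasure_distr emeasure_density indicator_inter_arith[symmetric] sets.Int)
    qed
    have step: "emeasure ?M (A \<inter> B (f x) n) = emeasure ?M (A \<inter> B x n)" if "x \<in> ?S" "r < n" for x n
    proof -
      have "A \<inter> B (f x) n \<in> sets ?M" using A B_sets S that by blast
      moreover have "f -` (A \<inter> B (f x) n) \<inter> ?S = A \<inter> B x n"
        using inv pre_ball[OF that(1)] B_sub[OF that] by blast
      ultimately show ?thesis using pres by metis
    qed
    have Q_B: "emeasure Q (B x n) = emeasure Q (B z n)" if xz: "x \<in> ?S" "z \<in> ?S" "r < n" for x z n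
    proof -
      have "emeasure ?M (A \<inter> B ((f ^^ j) x) n) = emeasure ?M (A \<inter> B x n)" for j
        by (induction j) (simp_all add: step fj xz)
      moreover obtain j where "residue ((f ^^ j) x) n = residue z n" using trans[OF xz(1,2)] by blast
      then have "B ((f ^^ j) x) n = B z n" by (simp add: B_def)
      ultimately show ?thesis unfolding Q[OF B_borel] by metis
    qed
    \<comment> \<open>\<open>X \<mapsto> \<mu>(A \<inter> X)\<close> is invariant, so it is a multiple of \<open>\<mu>\<close>; then take \<open>X = A\<close>.\<close>
    have total: "emeasure ?M A \<le> 1"
      using emeasure_space[of ?M A] by (simp add: emeasure_sphere_measure_sphere)
    have "Q = scale_measure (emeasure ?M A) N"
    proof (rule measure_eqI_sphere)
      show "emeasure Q (- ?S) = 0"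
      proof -
        have "A \<inter> - ?S = {}" using A'(2) by blast
        then show ?thesis using borel_padic_sphere[of y r] by (subst Q) simp_all
      qed
      show "emeasure (scale_measure (emeasure ?M A) N) (- ?S) = 0"
        using borel_padic_sphere[of y r] by (simp add: N)
      show "emeasure Q UNIV = emeasure (scale_measure (emeasure ?M A) N) UNIV"
        by (simp add: Q N emeasure_sphere_measure_sphere)
      show "emeasure Q UNIV \<noteq> \<infinity>" using total by (auto simp: Q top_unique)
      show "emeasure (scale_measure (emeasure ?M A) N) (residue_ball n (residue x n))
          = emeasure (scale_measure (emeasure ?M A) N) (residue_ball n (residue z n))"
        if "x \<in> ?S" "z \<in> ?S" "r < n" for x z n
        using N_B[OF that] by (simp only: B_def emeasure_scale_measure)
      show "sets Q = sets borel" "sets (scale_measure (emeasure ?M A) N) = sets borel"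
        by (simp_all add: N_def Q_def)
    qed (fact Q_B[unfolded B_def])
    then have "emeasure ?M A = emeasure ?M A * emeasure ?M A"
      using Q[of A] N[of A] A' by (simp add: Int_absorb2)
    \<comment> \<open>The bound \<open>total\<close> excludes the infinite solution of t = t *
      t.\<close>
    then show ?thesis
      using total by (metis ennreal_mult_cancel_left mult.right_neutral ennreal_top_neq_one top_unique infinity_ennreal_def)
  qed
  then show ?thesis
    using S f pres unfolding ergodic_on_sphere_def measure_preserving_def ergodic_def by simp
qed

text \<open>The points whose orbit meets that of \<open>a\<close> modulo p^n form an invariant union
  of balls. It has positive measure, hence measure 1, which leaves no room for a disjoint ball
  around \<open>b\<close>.\<close>

lemma ergodic_on_sphere_imp_orbits_meet:
  fixes f :: "'p::prime_card padic_int \<Rightarrow> 'p padic_int"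
  assumes erg: "ergodic_on_sphere f y r" and n: "r < n"
    and lip: "\<And>x z. x \<in> padic_sphere y r \<Longrightarrow> z \<in> padic_sphere y r \<Longrightarrow>
      residue x n = residue z n \<Longrightarrow> residue (f x) n = residue (f z) n"
    and a: "a \<in> padic_sphere y r" and b: "b \<in> padic_sphere y r"
  shows "\<exists>i j. residue ((f ^^ i) b) n = residue ((f ^^ j) a) n"
proof -
  let ?S = "padic_sphere y r" and ?M = "sphere_measure y r"
  have S: "f ` ?S \<subseteq> ?S" using erg by (simp add: ergodic_on_sphere_def)
  have fj: "(f ^^ j) x \<in> ?S" if "x \<in> ?S" for j x
    using that S by (induction j) auto
  have lip_j: "residue ((f ^^ j) x) n = residue ((f ^^ j) z) n"
    if "x \<in> ?S" "z \<in> ?S" "residue x n = residue z n" for j x z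
    using that by (induction j) (auto intro!: lip fj)
  \<comment> \<open>Iterating \<open>a\<close> as well as \<open>x\<close> makes \<open>A\<close>
    equal to its preimage: passing from \<open>x\<close> to \<open>f x\<close> is compensated by one
    more step of \<open>a\<close>.\<close>
  define A where "A = {x \<in> ?S. \<exists>i j. residue ((f ^^ i) x) n = residue ((f ^^ j) a) n}"
  have ball: "residue_ball n (residue x n) \<subseteq> A" if "x \<in> A" for x
  proof
    fix z :: "'p padic_int"
    assume z: "z \<in> residue_ball n (residue x n)"
    have x: "x \<in> ?S" using that by (simp add: A_def)
    then have "z \<in> ?S" using residue_ball_subset_sphere[OF x n] z by blast
    then show "z \<in> A" using that z lip_j[of z x] by (auto simp: A_def residue_ball_def)
  qed
  then have A_eq: "A = (\<Union>x\<in>A. residue_ball n (residue x n))"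
    by (auto simp: residue_ball_def)
  have "open A" by (subst A_eq) (intro open_UN ballI open_residue_ball)
  then have A: "A \<in> sets ?M" by (auto simp: mem_sets_sphere_measure_iff A_def)
  have "f -` A \<inter> ?S = A"
  proof (intro equalityI subsetI)
    fix x assume x: "x \<in> f -` A \<inter> ?S"
    then obtain i j where "residue ((f ^^ i) (f x)) n = residue ((f ^^ j) a) n"
      by (auto simp: A_def)
    then have "residue ((f ^^ Suc i) x) n = residue ((f ^^ j) a) n" by (simp add: funpow_swap1)
    then show "x \<in> A" using x unfolding A_def by blast
  next
    fix x assume x: "x \<in> A"
    then obtain i j where ij: "residue ((f ^^ i) x) n = residue ((f ^^ j) a) n" and xS: "x \<in> ?S"
      by (auto simp: A_def)
    have "residue (f ((f ^^ i) x)) n = residue (f ((f ^^ j) a)) n"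
      by (rule lip[OF fj[OF xS] fj[OF a] ij])
    then have "residue ((f ^^ i) (f x)) n = residue ((f ^^ Suc j) a) n" by (simp add: funpow_swap1)
    then show "x \<in> f -` A \<inter> ?S" using xS S unfolding A_def by blast
  qed
  then have "emeasure ?M A = 0 \<or> emeasure ?M A = 1"
    using erg A unfolding ergodic_on_sphere_def ergodic_def by simp
  moreover have "a \<in> A" using a unfolding A_def by blast
  then have "emeasure ?M (residue_ball n (residue a n)) \<le> emeasure ?M A"
    using ball A by (intro emeasure_mono) auto
  then have "emeasure ?M A \<noteq> 0" using emeasure_sphere_measure_ball_pos[OF a n] by auto
  ultimately have A1: "emeasure ?M A = 1" by blast
  have "b \<in> A"
  proof (rule ccontr)
    assume "b \<notin> A"
    let ?B = "residue_ball n (residue b n) :: 'p padic_int set"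
    have "?B \<inter> A = {}"
    proof (rule ccontr)
      assume "?B \<inter> A \<noteq> {}"
      then obtain z where z: "z \<in> A" "residue z n = residue b n" by (auto simp: residue_ball_def)
      then have "b \<in> residue_ball n (residue z n)" by (simp add: residue_ball_def)
      then show False using ball[OF z(1)] \<open>b \<notin> A\<close> by blast
    qed
    moreover have B: "?B \<in> sets ?M"
      using residue_ball_subset_sphere[OF b n]
      by (simp add: mem_sets_sphere_measure_iff borel_open open_residue_ball)
    ultimately have "emeasure ?M ?B + emeasure ?M A = emeasure ?M (?B \<union> A)"
      using A by (intro plus_emeasure) auto
    also have "\<dots> \<le> 1"
      using emeasure_space[of ?M "?B \<union> A"] by (simp add: emeasure_sphere_measure_sphere)
    finally have "emeasure ?M ?B + 1 \<le> 0 + 1" using A1 by simp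
    then have "emeasure ?M ?B \<le> 0" by (simp add: ennreal_add_left_cancel_le add.commute)
    then show False using emeasure_sphere_measure_ball_pos[OF b n] by simp
  qed
  then show ?thesis by (simp add: A_def)
qed


theorem proposition5p10:
  fixes r l :: nat
    and u q f :: "'p::prime_card padic_int \<Rightarrow> 'p padic_int"
  assumes "CARD('p) \<noteq> 2"
    and "r > 1"
    and "l > 0"
    and "u \<in> class_B"
    and "\<And>x. q x = of_nat CARD('p) ^ (r + 1) * u x"
    and "\<And>x. f x = x ^ l + q x"
  shows "ergodic_on_sphere f 1 r \<longleftrightarrow> generates_residue_units (CARD('p) ^ 2) l"
proof -
  let ?S = "padic_sphere (1 :: 'p padic_int) r"
  have f_eq: "f = (\<lambda>x. x ^ l + \<varpi> ^ (r + 1) * u x)" using assms(5,6) by (simp add: fun_eq_iff)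
  \<comment> \<open>Both directions use only this affine approximation of \<open>f\<close> and the
    congruence for \<open>f 1\<close>.\<close>
  have f: "near_affine r (of_nat l) f"
    unfolding f_eq using assms(2) class_B_lipschitz[OF assms(4)]
    by (intro near_affine_perturbed_monomial) simp_all
  have f1: "\<varpi> ^ (r + 1) dvd f 1 - 1" unfolding f_eq by simp
  have S: "\<varpi> ^ r dvd x - 1" if "x \<in> ?S" for x using that by (simp add: mem_padic_sphere_iff)
  have dvd_iff: "residue x n = residue z n \<longleftrightarrow> \<varpi> ^ n dvd x - z" for x z :: "'p padic_int" and n
    by (simp only: p_pow_dvd_iff residue_diff_eq_0_iff)
  show ?thesis
  proof
    assume erg: "ergodic_on_sphere f 1 r"
    have lip: "residue (f x) (r + 2) = residue (f z) (r + 2)"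
      if "x \<in> ?S" "z \<in> ?S" "residue x (r + 2) = residue z (r + 2)" for x z
      using near_affine_dvd_diff[OF f S[OF that(1)] S[OF that(2)]] that(3) unfolding dvd_iff .
    show "generates_residue_units (CARD('p) ^ 2) l"
    proof (rule generates_if_orbits_meet[OF assms(1) f f1])
      show "f ` ?S \<subseteq> ?S" using erg by (simp add: ergodic_on_sphere_def)
      show "\<exists>i j. \<varpi> ^ (r + 2) dvd (f ^^ i) x - (f ^^ j) z" if "x \<in> ?S" "z \<in> ?S" for x z
        using ergodic_on_sphere_imp_orbits_meet[OF erg _ lip that(2,1)]
        unfolding dvd_iff by simp
    qed
  next
    assume gen: "generates_residue_units (CARD('p) ^ 2) l"
    have "1 < CARD('p) ^ 2" by (intro one_less_power prime_gt_1_nat prime_card) simp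
    then have "coprime l (CARD('p) ^ 2)" using gen generates_residue_units_iff by blast
    then have L: "\<not> \<varpi> dvd (of_nat l :: 'p padic_int)" unfolding coprime_uniformizer_iff .
    show "ergodic_on_sphere f 1 r"
    proof (rule isometric_transitive_imp_ergodic_on_sphere)
      show "f ` ?S \<subseteq> ?S" using near_affine_sphere[OF f f1 L] by blast
      show "residue (f x) n = residue (f z) n \<longleftrightarrow> residue x n = residue z n"
        if "x \<in> ?S" "z \<in> ?S" for x z n
        unfolding dvd_iff by (rule near_affine_isometric[OF f L S[OF that(1)] S[OF that(2)]])
      show "\<exists>j. residue ((f ^^ j) x) n = residue z n" if "x \<in> ?S" "z \<in> ?S" for x z n
        unfolding dvd_iff by (rule generator_transitive[OF assms(1) f f1 gen that])
    qed
  qed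
qed

end
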